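(* Let $P, Q \in \mathbf{C}[x,y]$ and let $f = (P,Q) : \mathbf{C}^2_{(x,y)} \to \mathbf{C}^2_{(u,v)}$. Suppose that the Jacobian $J(P,Q) := P_x Q_y - P_y Q_x$ is a nonzero constant. Suppose that $\deg P = Kd$ and $\deg Q = Ke$ with $K, d, e$ positive integers and $\gcd(d,e) = 1$, and that $P$ and $Q$ have the form $$P(x,y) = A y^{Kd} + \dots + a_1(x) y + a_0(x), \quad A \neq 0, \qquad Q(x,y) = B y^{Ke} + \dots + b_1(x) y + b_0(x), \quad B \neq 0,$$ where $A, B \in \mathbf{C}$ are constants and the $a_i(x), b_j(x) \in \mathbf{C}[x]$ (so the coefficient of the top power of $y$ in each of $P$, $Q$ is a nonzero constant). If the non-proper value set $A_f$ is not empty, then every irreducible component of $A_f$ can be parameterized by a polynomial map of the form $$\xi \mapsto \big(A\xi^{md} + \text{terms of lower degree in } \xi,\; B\xi^{me} + \text{terms of lower degree in } \xi\big), \qquad m \in \mathbf{N}.$$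
   Context: For a dominant polynomial map $f : \mathbf{C}^2 \to \mathbf{C}^2$, the non-proper value set $A_f$ is the set of all points $a \in \mathbf{C}^2$ such that $f^{-1}(K)$ is not compact for every compact neighbourhood $K \subset \mathbf{C}^2$ of $a$ (equivalently, there is a sequence $p_i \in \mathbf{C}^2$ with $p_i \to \infty$ and $f(p_i) \to a$). When non-empty, $A_f$ is a plane algebraic curve. *)

theory Defs
  imports "HOL-Analysis.Analysis" "HOL-Computational_Algebra.Polynomial"
begin

text \<open>Bivariate polynomials in C[x,y] are represented as elements of (C[x])[y]:
  the outer polynomial variable is y, the coefficients are polynomials in x.\<close>

type_synonym bipoly = "complex poly poly"

definition eval2 :: "bipoly \<Rightarrow> complex \<Rightarrow> complex \<Rightarrow> complex" where
  "eval2 P x y = poly (map_poly (\<lambda>c. poly c x) P) y"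

definition totdeg :: "bipoly \<Rightarrow> nat" where
  "totdeg P = (if P = 0 then 0 else
     Max {degree (coeff P i) + i | i. i \<le> degree P \<and> coeff P i \<noteq> 0})"

definition dx :: "bipoly \<Rightarrow> bipoly" where
  "dx P = map_poly pderiv P"

definition dy :: "bipoly \<Rightarrow> bipoly" where
  "dy P = pderiv P"

definition jacobian :: "bipoly \<Rightarrow> bipoly \<Rightarrow> bipoly" where
  "jacobian P Q = dx P * dy Q - dy P * dx Q"

definition polymap :: "bipoly \<Rightarrow> bipoly \<Rightarrow> complex \<times> complex \<Rightarrow> complex \<times> complex" where
  "polymap P Q = (\<lambda>(x, y). (eval2 P x y, eval2 Q x y))"

definition nonproper_set :: "(complex \<times> complex \<Rightarrow> complex \<times> complex) \<Rightarrow> (complex \<times> complex) set" where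
  "nonproper_set f = {a. \<exists>p :: nat \<Rightarrow> complex \<times> complex.
      filterlim (\<lambda>i. norm (p i)) at_top sequentially \<and> (\<lambda>i. f (p i)) \<longlonglongrightarrow> a}"

definition zero_set :: "bipoly set \<Rightarrow> (complex \<times> complex) set" where
  "zero_set S = {(x, y). \<forall>p\<in>S. eval2 p x y = 0}"

definition algebraic_set :: "(complex \<times> complex) set \<Rightarrow> bool" where
  "algebraic_set X \<longleftrightarrow> (\<exists>S. X = zero_set S)"

definition irreducible_alg :: "(complex \<times> complex) set \<Rightarrow> bool" where
  "irreducible_alg X \<longleftrightarrow> algebraic_set X \<and> X \<noteq> {} \<and>
     (\<forall>Y Z. algebraic_set Y \<and> algebraic_set Z \<and> X = Y \<union> Z \<longrightarrow> X = Y \<or> X = Z)"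

definition irreducible_component :: "(complex \<times> complex) set \<Rightarrow> (complex \<times> complex) set \<Rightarrow> bool" where
  "irreducible_component C X \<longleftrightarrow> C \<subseteq> X \<and> irreducible_alg C \<and>
     (\<forall>D. irreducible_alg D \<and> C \<subseteq> D \<and> D \<subseteq> X \<longrightarrow> D = C)"

end

(*
  Along a sequence going to infinity with bounded image, x tends to infinity, because P and Q have
  constant leading coefficients in y. Put x = 1/s, y = xi/s^r with r large and write the map as
  (F/s^(alpha d), G/s^(alpha e)) with polynomials F, G in s and xi; then xi tends to 0. Blow up by
  s -> s^k, xi -> s^l xi, where l/k is the smallest slope of the Newton polygons of F and G, but
  never so large that alpha becomes negative. The ratio d : e of the exponents and of the orders,
  as well as the ratio of the leading coefficients, is preserved. Once alpha = 0, the values of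
  (F, G) at s = 0 trace a polynomial curve of the required shape. As long as alpha > 0, a limit
  point of xi is a common root of f = F(0, .) and g = G(0, .), and the constant Jacobian says that
  d f g' - e g f' is constant, hence 0, so f^e and g^d are proportional and the same configuration
  reappears at each root. The process ends because (multiplicity, alpha) decreases
  lexicographically. So the nonproper value set is a finite union of polynomial curves; these are
  irreducible and, by a resultant, closed, hence they contain all components. A final scaling of
  xi normalises the leading coefficients.
*)
theory Submission
  imports Defs "Subresultants.Subresultant_Gcd"
    "HOL-Computational_Algebra.Field_as_Ring"
    "HOL-Computational_Algebra.Fundamental_Theorem_Algebra"
begin

hide_const (open) module.smult

subsection \<open>Evaluation of bivariate polynomials\<close>

text \<open>The pair (A, B) itself is not preserved by the steps, because passing to a root of f and
  g replaces the leading coefficients by values of cofactors. What survives is the single relation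
  \<open>lead_coeff p ^ e * B ^ d = lead_coeff q ^ d * A ^ e\<close>, and it does two jobs. It fixes
  the scalar between f^e and g^d, which equal logarithmic derivatives leave open; and since gcd(d,
  e) = 1, it is exactly the condition under which one scalar t brings both coefficients of a final
  curve back to A and B. Slopes are rational. Substituting s^k instead of using fractional powers of
  s keeps every chart polynomial, but it multiplies \<alpha> by k, so \<alpha> may grow in a step.
  This is harmless when the multiplicity drops; when it does not, the slope turns out to be an
  integer, so k = 1 and \<alpha> does decrease. The Jacobian only yields some constant. A common
  root of f and g makes it 0, and a branch without common roots contributes no values, so nothing
  has to be shown there.\<close>

lemma eval2_0 [simp]: "eval2 0 x y = 0"
  by (simp add: eval2_def)

lemma eval2_pCons [simp]: "eval2 (pCons c F) x y = poly c x + y * eval2 F x y"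
  by (simp add: eval2_def Polynomial.map_poly_pCons)

text \<open>Evaluation is a composite of two ring homomorphisms, so sums and products are left to
  the simp rules for \<open>poly\<close>.\<close>

lemma eval2_poly_poly: "eval2 F x y = poly (poly F [:y:]) x"
  by (induction F) auto

lemma eval2_mult: "eval2 (F * G) x y = eval2 F x y * eval2 G x y"
  by (simp add: eval2_poly_poly)

lemma eval2_diff: "eval2 (F - G) x y = eval2 F x y - eval2 G x y"
  by (simp add: eval2_poly_poly)

text \<open>The free bound n lets a polynomial and its reweighted version, whose degree is only
  known to be no larger, be summed over the same rows.\<close>

lemma eval2_as_sum:
  assumes "degree F \<le> n"
  shows "eval2 F x y = (\<Sum>j\<le>n. poly (coeff F j) x * y ^ j)"
proof -
  have "degree (map_poly (\<lambda>c. poly c x) F) \<le> n"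
    using assms by (auto intro!: degree_le simp: coeff_map_poly coeff_eq_0)
  then have "eval2 F x y = (\<Sum>j\<le>n. coeff (map_poly (\<lambda>c. poly c x) F) j * y ^ j)"
    unfolding eval2_def poly_altdef by (intro sum.mono_neutral_left) (auto simp: coeff_eq_0)
  then show ?thesis by (simp add: coeff_map_poly)
qed

lemma tendsto_eval2 [tendsto_intros]:
  assumes "(f \<longlongrightarrow> a) net" "(g \<longlongrightarrow> b) net"
  shows "((\<lambda>i. eval2 F (f i) (g i)) \<longlongrightarrow> eval2 F a b) net"
  by (induction F) (auto intro!: tendsto_intros assms)

lemma has_field_derivative_eval2:
  assumes g: "(g has_field_derivative g') (at s)" and h: "(h has_field_derivative h') (at s)"
  shows "((\<lambda>s. eval2 F (g s) (h s)) has_field_derivative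
           eval2 (dx F) (g s) (h s) * g' + eval2 (dy F) (g s) (h s) * h') (at s)"
proof (induction F)
  case 0
  then show ?case by (simp add: dx_def dy_def)
next
  case (pCons c F)
  have c: "((\<lambda>s. poly c (g s)) has_field_derivative poly (pderiv c) (g s) * g') (at s)"
    using DERIV_chain2[OF poly_DERIV g] .
  have eq: "dx (pCons c F) = pCons (pderiv c) (dx F)" "dy (pCons c F) = F + pCons 0 (dy F)"
    by (simp_all add: dx_def dy_def Polynomial.map_poly_pCons pderiv_pCons)
  have add: "eval2 (F + G) x y = eval2 F x y + eval2 G x y" for G x y
    by (simp add: eval2_poly_poly)
  show ?case
    unfolding eval2_pCons eq add
    by (rule derivative_eq_intros c h pCons.IH refl | simp add: algebra_simps)+
qed

section \<open>Translation, restriction to s = 0, and monomial substitutions\<close>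

definition translate_y :: "complex \<Rightarrow> bipoly \<Rightarrow> bipoly" where
  "translate_y c F = pcompose F [:[:c:], 1:]"

lemma eval2_translate_y [simp]: "eval2 (translate_y c F) s \<xi> = eval2 F s (\<xi> + c)"
  by (simp add: translate_y_def eval2_poly_poly poly_pcompose add.commute)

text \<open>The restriction of a chart polynomial to the line s = 0, which represents
  infinity.\<close>

definition special :: "bipoly \<Rightarrow> complex poly" where
  "special F = map_poly (\<lambda>c. poly c 0) F"

lemma poly_special: "poly (special F) \<xi> = eval2 F 0 \<xi>"
  by (simp add: special_def eval2_def)

lemma coeff_special: "coeff (special F) j = poly (coeff F j) 0"
  by (simp add: special_def coeff_map_poly)

lemma poly_pderiv_special: "poly (pderiv (special F)) \<xi> = eval2 (dy F) 0 \<xi>"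
proof -
  have "((\<lambda>\<xi>. eval2 F 0 \<xi>) has_field_derivative eval2 (dy F) 0 \<xi>) (at \<xi>)"
    using has_field_derivative_eval2[of "\<lambda>_. 0" 0 \<xi> "\<lambda>\<xi>. \<xi>" 1 F] by simp
  moreover have "((\<lambda>\<xi>. eval2 F 0 \<xi>) has_field_derivative poly (pderiv (special F)) \<xi>) (at \<xi>)"
    by (simp flip: poly_special)
  ultimately show ?thesis by (metis DERIV_unique)
qed

lemma special_translate_y: "special (translate_y c F) = pcompose (special F) [:c, 1:]"
  by (rule poly_eq_poly_eq_iff[THEN iffD1])
     (simp add: poly_special poly_pcompose add.commute fun_eq_iff)

text \<open>Replaces each monomial \<open>x\<^sup>i y\<^sup>j\<close> by \<open>s\<^bsup>w i j\<^esup> \<xi>\<^sup>j\<close>.\<close>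

definition reweight :: "(nat \<Rightarrow> nat \<Rightarrow> nat) \<Rightarrow> bipoly \<Rightarrow> bipoly" where
  "reweight w F = (\<Sum>j\<le>degree F. monom (\<Sum>i\<le>degree (coeff F j). monom (coeff (coeff F j) i) (w i j)) j)"

lemma coeff_reweight:
  "coeff (reweight w F) j = (\<Sum>i\<le>degree (coeff F j). monom (coeff (coeff F j) i) (w i j))"
  by (auto simp: reweight_def coeff_sum coeff_eq_0)

lemma degree_reweight_le: "degree (reweight w F) \<le> degree F"
  by (rule degree_le) (simp add: coeff_reweight coeff_eq_0)

lemma poly_coeff_reweight:
  assumes "\<And>i. coeff (coeff F j) i \<noteq> 0 \<Longrightarrow> t ^ w i j = r * x ^ i"
  shows "poly (coeff (reweight w F) j) t = r * poly (coeff F j) x"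
proof -
  have "coeff (coeff F j) i * t ^ w i j = r * (coeff (coeff F j) i * x ^ i)" for i
    using assms[of i] by (cases "coeff (coeff F j) i = 0") auto
  then show ?thesis
    unfolding coeff_reweight poly_sum poly_monom poly_altdef[of "coeff F j"] sum_distrib_left
    by (intro sum.cong refl) auto
qed

text \<open>An identity between monomials suffices, and only on the support of F: the weights used
  later are truncated differences, which have the intended value only there.\<close>

lemma eval2_reweight:
  assumes "\<And>i j. coeff (coeff F j) i \<noteq> 0 \<Longrightarrow> t ^ w i j * \<xi> ^ j = r * x ^ i * y ^ j"
  shows "eval2 (reweight w F) t \<xi> = r * eval2 F x y"
proof -
  have "poly (coeff (reweight w F) j) t * \<xi> ^ j = r * (poly (coeff F j) x * y ^ j)" for j
  proof -
    have "coeff (coeff F j) i * t ^ w i j * \<xi> ^ j = r * (coeff (coeff F j) i * x ^ i * y ^ j)" for i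
      using assms[of j i] by (cases "coeff (coeff F j) i = 0") (auto simp: algebra_simps)
    then show ?thesis
      unfolding coeff_reweight poly_sum poly_monom poly_altdef[of "coeff F j"] sum_distrib_left sum_distrib_right
      by (intro sum.cong refl) auto
  qed
  then show ?thesis
    using eval2_as_sum[OF degree_reweight_le, of w F t \<xi>]
    by (simp add: eval2_as_sum[of F "degree F"] sum_distrib_left)
qed

text \<open>At s = 0 exactly the monomials of weight 0 survive, and here row j has the single
  candidate \<open>i0\<close>.\<close>

lemma coeff_special_reweight:
  assumes "\<And>i. coeff (coeff F j) i \<noteq> 0 \<Longrightarrow> w i j = 0 \<longleftrightarrow> i = i0"
  shows "coeff (special (reweight w F)) j = coeff (coeff F j) i0"
proof -
  have "coeff (special (reweight w F)) j = (\<Sum>i\<le>degree (coeff F j). if i = i0 then coeff (coeff F j) i else 0)"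
    unfolding coeff_special coeff_reweight poly_sum poly_monom power_0_left
    by (intro sum.cong refl) (metis assms mult_zero_left mult.right_neutral mult_zero_right)
  also have "\<dots> = coeff (coeff F j) i0"
    by (auto simp: coeff_eq_0)
  finally show ?thesis .
qed

lemma coeff_special_reweight_nonzero:
  assumes "coeff (special (reweight w F)) j \<noteq> 0"
  obtains i where "coeff (coeff F j) i \<noteq> 0" "w i j = 0"
proof -
  have "\<exists>i. coeff (coeff F j) i \<noteq> 0 \<and> w i j = 0"
  proof (rule ccontr)
    assume "\<not> ?thesis"
    then have "coeff (special (reweight w F)) j = 0"
      unfolding coeff_special coeff_reweight poly_sum poly_monom power_0_left
      by (intro sum.neutral) auto
    with assms show False by simp
  qed
  with that show ?thesis by blast
qed

section \<open>Bounded values force bounded arguments\<close>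

text \<open>Cauchy's bound for roots, with coefficients that depend on i. Eventually the leading
  coefficient exceeds \<open>norm l / 2\<close>; if then |z| > 1, the value and all lower terms are
  at most a constant times |z|^(n - 1), which bounds |z| by \<open>2 * M / norm l\<close>.\<close>

lemma Bseq_polynomial_argument:
  fixes c :: "nat \<Rightarrow> nat \<Rightarrow> complex" and z :: "nat \<Rightarrow> complex"
  assumes n: "n > 0"
    and lead: "c n \<longlonglongrightarrow> l" "l \<noteq> 0"
    and coeffs: "\<And>j. j < n \<Longrightarrow> Bseq (c j)"
    and val: "Bseq (\<lambda>i. \<Sum>j\<le>n. c j i * z i ^ j)"
  shows "Bseq z"
proof -
  have "\<forall>j. \<exists>B. j < n \<longrightarrow> (\<forall>i. norm (c j i) \<le> B)"
    using coeffs by (meson BseqE)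
  then obtain B where B: "\<And>j i. j < n \<Longrightarrow> norm (c j i) \<le> B j" by metis
  obtain V where V: "\<And>i. norm (\<Sum>j\<le>n. c j i * z i ^ j) \<le> V"
    using val by (meson BseqE)
  have V0: "V \<ge> 0" using V[of 0] norm_ge_zero order_trans by blast
  have B0: "B j \<ge> 0" if "j < n" for j using B[OF that, of 0] norm_ge_zero order_trans by blast
  define M where "M = V + (\<Sum>j<n. B j)"
  have M0: "M \<ge> 0" unfolding M_def using V0 B0 by (auto intro!: add_nonneg_nonneg sum_nonneg)
  have "(\<lambda>i. norm (c n i)) \<longlonglongrightarrow> norm l" using lead tendsto_norm by blast
  moreover have "norm l / 2 < norm l" using lead by simp
  ultimately have "eventually (\<lambda>i. norm l / 2 < norm (c n i)) sequentially"
    by (rule order_tendstoD)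
  moreover have "norm (z i) \<le> max 1 (2 * M / norm l)" if i: "norm l / 2 < norm (c n i)" for i
  proof (cases "norm (z i) \<le> 1")
    case False
    define r where "r = norm (z i)"
    have r: "r > 1" using False r_def by simp
    have pw: "r ^ j \<le> r ^ (n - 1)" if "j < n" for j
      using r that by (intro power_increasing) auto
    have "c n i * z i ^ n = (\<Sum>j\<le>n. c j i * z i ^ j) - (\<Sum>j<n. c j i * z i ^ j)"
      using n by (simp add: sum.lessThan_Suc flip: lessThan_Suc_atMost)
    then have "norm (c n i * z i ^ n) \<le> norm (\<Sum>j\<le>n. c j i * z i ^ j) + norm (\<Sum>j<n. c j i * z i ^ j)"
      by (metis norm_triangle_ineq4)
    also have "norm (\<Sum>j<n. c j i * z i ^ j) \<le> (\<Sum>j<n. B j * r ^ (n - 1))"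
      by (rule sum_norm_le)
         (use B0 pw B r in \<open>auto simp: norm_mult norm_power r_def intro!: mult_mono\<close>)
    also have "norm (\<Sum>j\<le>n. c j i * z i ^ j) \<le> V * r ^ (n - 1)"
      using V[of i] mult_left_mono[OF one_le_power[of r "n - 1"] V0] r by auto
    finally have "norm (c n i) * r ^ n \<le> M * r ^ (n - 1)"
      by (simp add: M_def norm_mult norm_power r_def sum_distrib_right algebra_simps)
    moreover have "r ^ n = r * r ^ (n - 1)" using n by (simp add: power_eq_if)
    ultimately have "norm (c n i) * r \<le> M" using r by (simp add: mult.assoc[symmetric])
    then have "norm l / 2 * r \<le> M"
      using mult_right_mono[of "norm l / 2" "norm (c n i)" r] i r by linarith
    then have "r \<le> 2 * M / norm l" using lead by (simp add: field_simps)
    then show ?thesis by (simp add: r_def)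
  qed auto
  ultimately have "eventually (\<lambda>i. norm (z i) \<le> max 1 (2 * M / norm l)) sequentially"
    by (auto elim: eventually_mono)
  then show ?thesis by (rule BfunI)
qed

text \<open>A constant leading coefficient cannot degenerate as s varies, and the other coefficients
  are bounded on a disc containing all \<open>s i\<close>.\<close>

lemma Bseq_eval2_argument:
  assumes "degree F > 0" and "lead_coeff F = [:a:]" "a \<noteq> 0"
    and s: "Bseq s" and v: "Bseq (\<lambda>i. eval2 F (s i) (z i))"
  shows "Bseq z"
proof (rule Bseq_polynomial_argument[where c = "\<lambda>j i. poly (coeff F j) (s i)" and l = a])
  obtain R where R: "\<And>i. norm (s i) \<le> R" using s by (meson BseqE)
  show "Bseq (\<lambda>i. poly (coeff F j) (s i))" for j
  proof -
    have "compact (poly (coeff F j) ` cball 0 R)"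
      by (intro compact_continuous_image continuous_intros compact_cball)
    then obtain B where "\<And>x. x \<in> cball 0 R \<Longrightarrow> norm (poly (coeff F j) x) \<le> B"
      by (meson bounded_iff compact_imp_bounded image_eqI)
    then show ?thesis using R by (intro BseqI'[of _ B]) auto
  qed
qed (use assms in \<open>auto simp: eval2_as_sum[OF order_refl]\<close>)

subsection \<open>Univariate polynomials\<close>

text \<open>The hypothesis says r'/r = V'/V. The top coefficients of the two products are deg r and
  deg V times the same nonzero number; constants are treated apart because their derivative has no
  such top coefficient.\<close>

lemma degree_eq_if_pderiv_mult_eq:
  fixes r V :: "complex poly"
  assumes eq: "pderiv r * V = r * pderiv V" and nz: "r \<noteq> 0" "V \<noteq> 0"
  shows "degree r = degree V"
proof (cases "degree r = 0 \<or> degree V = 0")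
  case True
  then have "pderiv r = 0 \<or> pderiv V = 0" by (simp add: pderiv_eq_0_iff)
  then have "pderiv r = 0 \<and> pderiv V = 0" using eq nz by auto
  then show ?thesis by (simp add: pderiv_eq_0_iff)
next
  case False
  have lc: "lead_coeff (pderiv p) = of_nat (degree p) * lead_coeff p" if "degree p \<noteq> 0" for p :: "complex poly"
    using that by (simp add: degree_pderiv coeff_pderiv)
  have "lead_coeff (pderiv r) * lead_coeff V = lead_coeff r * lead_coeff (pderiv V)"
    by (metis eq lead_coeff_mult)
  then have "of_nat (degree r) * (lead_coeff r * lead_coeff V) = of_nat (degree V) * (lead_coeff r * lead_coeff V)"
    using False lc[of r] lc[of V] by (metis mult.assoc mult.commute)
  then show ?thesis using nz by simp
qed

text \<open>U = p^e and V = q^d have equal logarithmic derivatives, hence so has their combination r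
  unless it is 0. Then r would have the degree of V, whereas \<open>lead\<close> cancels its
  coefficient in that degree.\<close>

lemma power_proportional_if_wronskian_zero:
  fixes p q :: "complex poly" and A B :: complex
  assumes w: "smult (of_nat d) (p * pderiv q) = smult (of_nat e) (q * pderiv p)"
    and de: "d > 0" "e > 0" and \<mu>: "\<mu> > 0"
    and deg: "degree p = \<mu> * d" "degree q = \<mu> * e"
    and lead: "lead_coeff p ^ e * B ^ d = lead_coeff q ^ d * A ^ e"
  shows "smult (B ^ d) (p ^ e) = smult (A ^ e) (q ^ d)"
proof (rule ccontr)
  assume ne: "\<not> ?thesis"
  define U where "U = p ^ e"
  define V where "V = q ^ d"
  define r where "r = smult (B ^ d) U - smult (A ^ e) V"
  have r: "r \<noteq> 0" using ne by (simp add: r_def U_def V_def)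
  have pq: "p \<noteq> 0" "q \<noteq> 0" using deg de \<mu> by auto
  have degU: "degree U = \<mu> * d * e" and degV: "degree V = \<mu> * d * e"
    using deg pq by (simp_all add: U_def V_def degree_power_eq)
  have "pderiv U * V = U * pderiv V"
  proof -
    have "pderiv U * V = (p ^ (e - 1) * q ^ (d - 1) * smult (of_nat e) (q * pderiv p))"
      unfolding U_def V_def pderiv_power using de by (cases d) (auto simp: ac_simps)
    also have "\<dots> = p ^ (e - 1) * q ^ (d - 1) * smult (of_nat d) (p * pderiv q)"
      by (simp add: w)
    also have "\<dots> = U * pderiv V"
      unfolding U_def V_def pderiv_power using de by (cases e) (auto simp: ac_simps)
    finally show ?thesis .
  qed
  then have "pderiv r * V = r * pderiv V"
    by (simp add: r_def pderiv_diff pderiv_smult algebra_simps)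
  moreover have "V \<noteq> 0" using pq by (simp add: V_def)
  ultimately have degr: "degree r = \<mu> * d * e"
    using degree_eq_if_pderiv_mult_eq r degV by metis
  have "coeff r (\<mu> * d * e) = B ^ d * lead_coeff U - A ^ e * lead_coeff V"
    by (simp add: r_def degU degV)
  also have "\<dots> = 0"
    using lead by (simp add: U_def V_def lead_coeff_power ac_simps)
  finally show False using degr r by (metis leading_coeff_0_iff)
qed

text \<open>Moving the point c to 0 turns the multiplicity of a root into the index of the lowest
  coefficient. This is how orders of roots become conditions on coefficients.\<close>

lemma coeff_pcompose_order:
  fixes p :: "complex poly"
  assumes "p = [:-c, 1:] ^ n * R"
  shows "j < n \<Longrightarrow> coeff (pcompose p [:c, 1:]) j = 0"
    and "coeff (pcompose p [:c, 1:]) n = poly R c"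
proof -
  have "pcompose ([:-c, 1:] ^ n) [:c, 1:] = monom 1 n"
    by (rule poly_eq_poly_eq_iff[THEN iffD1]) (simp add: poly_pcompose poly_monom fun_eq_iff)
  then have eq: "pcompose p [:c, 1:] = monom 1 n * pcompose R [:c, 1:]"
    by (simp add: assms pcompose_mult)
  show "j < n \<Longrightarrow> coeff (pcompose p [:c, 1:]) j = 0"
    unfolding eq coeff_monom_mult by simp
  show "coeff (pcompose p [:c, 1:]) n = poly R c"
    unfolding eq coeff_monom_mult by simp
qed

lemma order_power:
  fixes p :: "complex poly"
  assumes "p \<noteq> 0"
  shows "order c (p ^ n) = n * order c p"
proof (induction n)
  case (Suc n)
  have "order c (p * p ^ n) = order c p + order c (p ^ n)"
    using assms by (intro order_mult) simp
  with Suc show ?case by simp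
qed simp

text \<open>Comparing orders at c gives e ord(p) = d ord(q), and coprimality splits off the common
  factor \<mu>. Once the powers of the linear factor are cancelled, evaluation at c hands the
  relation on to the cofactors.\<close>

lemma common_multiplicity:
  fixes p q :: "complex poly" and A B :: complex
  assumes eq: "smult (B ^ d) (p ^ e) = smult (A ^ e) (q ^ d)"
    and nz: "p \<noteq> 0" "q \<noteq> 0" "A \<noteq> 0" "B \<noteq> 0"
    and de: "d > 0" "e > 0" "gcd d e = 1"
    and root: "poly p c = 0"
  obtains \<mu> R S where "\<mu> > 0" "order c p = \<mu> * d" "order c q = \<mu> * e"
    "p = [:-c, 1:] ^ (\<mu> * d) * R" "q = [:-c, 1:] ^ (\<mu> * e) * S" "poly R c \<noteq> 0" "poly S c \<noteq> 0"
    "poly R c ^ e * B ^ d = poly S c ^ d * A ^ e"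
proof -
  have "e * order c p = d * order c q"
    using arg_cong[OF eq, of "order c"] nz by (simp add: order_smult order_power)
  then have "d dvd e * order c p" by simp
  then have "d dvd order c p" using de(3) by (metis coprime_dvd_mult_right_iff coprime_iff_gcd_eq_1)
  then obtain \<mu> where \<mu>: "order c p = \<mu> * d" by (metis dvdE mult.commute)
  with \<open>e * order c p = d * order c q\<close> have \<mu>': "order c q = \<mu> * e"
    using de by (simp add: ac_simps)
  obtain R where R: "p = [:-c, 1:] ^ (\<mu> * d) * R" "\<not> [:-c, 1:] dvd R"
    using order_decomp[OF nz(1)] \<mu> by metis
  obtain S where S: "q = [:-c, 1:] ^ (\<mu> * e) * S" "\<not> [:-c, 1:] dvd S"
    using order_decomp[OF nz(2)] \<mu>' by metis
  have "[:-c, 1:] ^ (\<mu> * d * e) * smult (B ^ d) (R ^ e) = [:-c, 1:] ^ (\<mu> * d * e) * smult (A ^ e) (S ^ d)"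
    using eq unfolding R(1) S(1) by (simp add: power_mult_distrib power_mult[symmetric] ac_simps)
  moreover have "[:-c, 1:] ^ (\<mu> * d * e) \<noteq> 0" by simp
  ultimately have "smult (B ^ d) (R ^ e) = smult (A ^ e) (S ^ d)" by (metis mult_left_cancel)
  then have "poly (smult (B ^ d) (R ^ e)) c = poly (smult (A ^ e) (S ^ d)) c" by simp
  then have "poly R c ^ e * B ^ d = poly S c ^ d * A ^ e" by (simp add: mult.commute)
  moreover have "\<mu> > 0" using root \<mu> nz by (metis mult_0 neq0_conv order_root)
  ultimately show ?thesis
    using that \<mu> \<mu>' R S by (metis poly_eq_0_iff_dvd)
qed

lemma lead_coeff_linear_power: "lead_coeff ([:- c, 1:: complex:] ^ n) = 1"
  by (subst lead_coeff_power) simp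

lemma maximal_order_decomp:
  fixes p :: "complex poly"
  assumes "p \<noteq> 0" "order c p = degree p"
  shows "p = smult (lead_coeff p) ([:-c, 1:] ^ degree p)"
proof -
  obtain R where R: "p = [:-c, 1:] ^ degree p * R"
    using order_decomp[OF assms(1), of c] assms(2) by metis
  then have "R \<noteq> 0" using assms(1) by auto
  then have "degree p = degree p + degree R"
    by (metis R assms(1) degree_linear_power degree_mult_eq mult_zero_left)
  then obtain k where k: "R = [:k:]" by (metis add_cancel_left_right degree_eq_zeroE)
  then have p: "p = smult k ([:-c, 1:] ^ degree p)" using R by (simp add: mult.commute)
  then have "lead_coeff p = k"
    by (metis lead_coeff_smult lead_coeff_linear_power mult.right_neutral)
  with p show ?thesis by simp
qed

lemma coeff_linear_power_pred:
  fixes c :: complex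
  assumes "n > 0"
  shows "coeff ([:-c, 1:] ^ n) (n - 1) = - (of_nat n * c)"
proof -
  have "coeff ([:-c, 1:] ^ Suc m) m = - (of_nat (Suc m) * c)" for m
  proof (induction m)
    case (Suc m)
    have "coeff ([:-c, 1:] ^ Suc m) (Suc m) = 1"
      by (metis degree_linear_power lead_coeff_linear_power)
    then show ?case
      using Suc by (simp add: algebra_simps)
  qed simp
  from this[of "n - 1"] assms show ?thesis by simp
qed

text \<open>The required factors a and b satisfy a^e = b^d. With d x = e y + 1, the number z = a^x /
  b^y solves both z^d = a and z^e = b, and t is any m-th root of z.\<close>

lemma ex_rescaling_leading_coeffs:
  fixes p q :: "complex poly" and A B :: complex
  assumes de: "d > 0" "e > 0" "gcd d e = 1" and m: "m > 0"
    and deg: "degree p = m * d" "degree q = m * e" and AB: "A \<noteq> 0" "B \<noteq> 0"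
    and lead: "lead_coeff p ^ e * B ^ d = lead_coeff q ^ d * A ^ e"
  obtains t where "t \<noteq> 0" "lead_coeff p * t ^ (m * d) = A" "lead_coeff q * t ^ (m * e) = B"
proof -
  have pq: "lead_coeff p \<noteq> 0" "lead_coeff q \<noteq> 0"
    using deg de m by (metis degree_0 leading_coeff_0_iff less_irrefl mult_pos_pos)+
  obtain x y where xy: "d * x = e * y + 1"
    using bezout_nat[of d e] de by auto
  define a where "a = A / lead_coeff p"
  define b where "b = B / lead_coeff q"
  have ab: "a \<noteq> 0" "b \<noteq> 0" using AB pq by (simp_all add: a_def b_def)
  have eq: "a ^ e = b ^ d"
    using lead AB pq by (simp add: a_def b_def field_simps)
  define z where "z = a ^ x / b ^ y"
  have "z ^ d = a"
  proof -
    have "z ^ d = a ^ (d * x) / (b ^ d) ^ y" by (simp add: z_def power_divide power_mult[symmetric] mult.commute)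
    also have "\<dots> = a" using ab by (simp add: eq[symmetric] xy power_add power_mult)
    finally show ?thesis .
  qed
  moreover have "z ^ e = b"
  proof -
    have "z ^ e = (a ^ e) ^ x / b ^ (e * y)" by (simp add: z_def power_divide power_mult[symmetric] mult.commute)
    also have "\<dots> = b ^ (d * x) / b ^ (e * y)" by (simp add: eq power_mult)
    also have "\<dots> = b" using ab by (simp add: xy power_add)
    finally show ?thesis .
  qed
  moreover obtain t where "t ^ m = z" using exists_complex_root[of m z] m by auto
  ultimately have "t ^ (m * d) = a" "t ^ (m * e) = b" by (simp_all add: power_mult)
  moreover have "t \<noteq> 0" using calculation ab m de by (metis mult_pos_pos zero_power)
  ultimately show ?thesis using that pq by (simp add: a_def b_def)
qed

subsection \<open>Polynomial curves as algebraic sets\<close>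

lemma comm_ring_hom_eval2: "comm_ring_hom (\<lambda>F. eval2 F x y)"
  by unfold_locales (simp_all add: eval2_poly_poly)

lemma algebraic_set_Int: "algebraic_set X \<Longrightarrow> algebraic_set Y \<Longrightarrow> algebraic_set (X \<inter> Y)"
proof -
  assume "algebraic_set X" "algebraic_set Y"
  then obtain S T where "X = zero_set S" "Y = zero_set T" by (auto simp: algebraic_set_def)
  then have "X \<inter> Y = zero_set (S \<union> T)" by (auto simp: zero_set_def)
  then show ?thesis by (auto simp: algebraic_set_def)
qed

lemma algebraic_set_Un: "algebraic_set X \<Longrightarrow> algebraic_set Y \<Longrightarrow> algebraic_set (X \<union> Y)"
proof -
  assume "algebraic_set X" "algebraic_set Y"
  then obtain S T where ST: "X = zero_set S" "Y = zero_set T" by (auto simp: algebraic_set_def)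
  have "X \<union> Y = zero_set {f * g | f g. f \<in> S \<and> g \<in> T}"
  proof (intro Set.equalityI Set.subsetI)
    fix z assume "z \<in> X \<union> Y"
    then show "z \<in> zero_set {f * g | f g. f \<in> S \<and> g \<in> T}"
      by (auto simp: ST zero_set_def eval2_mult)
  next
    fix z assume z: "z \<in> zero_set {f * g | f g. f \<in> S \<and> g \<in> T}"
    show "z \<in> X \<union> Y"
    proof (rule ccontr)
      assume "z \<notin> X \<union> Y"
      then obtain f g where "f \<in> S" "g \<in> T" "eval2 f (fst z) (snd z) \<noteq> 0" "eval2 g (fst z) (snd z) \<noteq> 0"
        by (auto simp: ST zero_set_def split: prod.splits)
      moreover from this(1,2) have "f * g \<in> {f * g | f g. f \<in> S \<and> g \<in> T}" by blast
      with z have "eval2 (f * g) (fst z) (snd z) = 0"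
        unfolding zero_set_def by (simp only: mem_Collect_eq case_prod_beta)
      ultimately show False by (simp add: eval2_mult)
    qed
  qed
  then show ?thesis by (auto simp: algebraic_set_def)
qed

lemma algebraic_set_empty: "algebraic_set {}"
proof -
  have "{} = zero_set {1}" by (auto simp: zero_set_def eval2_poly_poly)
  then show ?thesis by (auto simp: algebraic_set_def)
qed

lemma irreducible_alg_subset_Union:
  assumes "finite \<D>" "irreducible_alg C" "C \<subseteq> \<Union>\<D>" "\<And>D. D \<in> \<D> \<Longrightarrow> algebraic_set D"
  shows "\<exists>D\<in>\<D>. C \<subseteq> D"
  using assms
proof (induction \<D> rule: finite_induct)
  case empty
  then show ?case by (auto simp: irreducible_alg_def)
next
  case (insert D \<D>)
  have alg: "algebraic_set (\<Union>\<D>)"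
    using insert.hyps(1) insert.prems(3)
    by (induction \<D> rule: finite_induct) (auto intro: algebraic_set_empty algebraic_set_Un)
  have "C = C \<inter> D \<union> C \<inter> \<Union>\<D>" using insert.prems by auto
  moreover have "algebraic_set (C \<inter> D)" "algebraic_set (C \<inter> \<Union>\<D>)"
    using insert.prems alg by (auto intro!: algebraic_set_Int simp: irreducible_alg_def)
  ultimately have "C = C \<inter> D \<or> C = C \<inter> \<Union>\<D>"
    using insert.prems(1) unfolding irreducible_alg_def by metis
  then consider "C \<subseteq> D" | "C \<subseteq> \<Union>\<D>" by blast
  then show ?case
  proof cases
    case 2
    then have "\<exists>D\<in>\<D>. C \<subseteq> D" by (intro insert.IH insert.prems(1,3)) auto
    then show ?thesis by simp
  qed simp
qed

text \<open>The image is the zero set of the resultant of \<open>p(\<xi>) - x\<close> and \<open>q(\<xi>) - y\<close> with respect to \<open>\<xi>\<close>.\<close>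

lemma algebraic_set_polynomial_curve:
  fixes p q :: "complex poly"
  assumes deg: "degree p > 0" "degree q > 0"
  shows "algebraic_set (range (\<lambda>\<xi>. (poly p \<xi>, poly q \<xi>)))"
proof -
  define lft :: "complex poly \<Rightarrow> bipoly poly" where "lft = map_poly (\<lambda>c. [:[:c:]:])"
  define f where "f = lft p - [:[:[:0, 1:]:]:]"
  define g where "g = lft q - [:[:0, 1:]:]"
  have "eval2 (resultant f g) u v = 0 \<longleftrightarrow> (\<exists>\<xi>. poly p \<xi> = u \<and> poly q \<xi> = v)" for u v
  proof -
    interpret h: comm_ring_hom "\<lambda>F. eval2 F u v" by (rule comm_ring_hom_eval2)
    have lift: "map_poly (\<lambda>F. eval2 F u v) (lft r) = r" for r
      unfolding lft_def by (subst map_poly_map_poly) (simp_all add: o_def)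
    have degl: "degree (lft r) = degree r" for r
      unfolding lft_def by (rule degree_map_poly) auto
    \<comment> \<open>Subtracting a constant leaves a positive degree unchanged. So evaluating x and
      y lowers neither degree, and the resultant commutes with the evaluation.\<close>
    have degm: "degree (r - [:c:]) = degree r" if "degree r > 0" for r :: "'a::comm_ring_1 poly" and c
    proof -
      have "r - [:c:] = r + [:-c:]" by (rule poly_eqI) (simp add: coeff_pCons split: nat.splits)
      then show ?thesis using degree_add_eq_left[of "[:-c:]" r] that by (metis degree_pCons_0)
    qed
    have mdiff: "map_poly (\<lambda>F. eval2 F u v) (r - t) = map_poly (\<lambda>F. eval2 F u v) r - map_poly (\<lambda>F. eval2 F u v) t" for r t
      by (rule poly_eqI) (simp add: coeff_map_poly eval2_poly_poly)
    have mf: "map_poly (\<lambda>F. eval2 F u v) f = p - [:u:]"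
      unfolding f_def by (simp add: mdiff lift Polynomial.map_poly_pCons)
    have mg: "map_poly (\<lambda>F. eval2 F u v) g = q - [:v:]"
      unfolding g_def by (simp add: mdiff lift Polynomial.map_poly_pCons)
    have "eval2 (resultant f g) u v = resultant (p - [:u:]) (q - [:v:])"
      using h.resultant_map_poly[of f g] unfolding mf mg
      by (simp add: f_def g_def degm degl deg)
    also have "\<dots> = 0 \<longleftrightarrow> degree (gcd (p - [:u:]) (q - [:v:])) \<noteq> 0"
      by (rule resultant_0_gcd)
    also have "\<dots> \<longleftrightarrow> (\<exists>\<xi>. poly (p - [:u:]) \<xi> = 0 \<and> poly (q - [:v:]) \<xi> = 0)"
    proof
      assume "degree (gcd (p - [:u:]) (q - [:v:])) \<noteq> 0"
      then obtain \<xi> where "poly (gcd (p - [:u:]) (q - [:v:])) \<xi> = 0"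
        using alg_closed_imp_poly_has_root by (metis gr0I)
      then show "\<exists>\<xi>. poly (p - [:u:]) \<xi> = 0 \<and> poly (q - [:v:]) \<xi> = 0"
        using dvd_trans[OF _ gcd_dvd1] dvd_trans[OF _ gcd_dvd2] unfolding poly_eq_0_iff_dvd by blast
    next
      assume "\<exists>\<xi>. poly (p - [:u:]) \<xi> = 0 \<and> poly (q - [:v:]) \<xi> = 0"
      then obtain \<xi> where "[:-\<xi>, 1:] dvd gcd (p - [:u:]) (q - [:v:])"
        by (meson gcd_greatest poly_eq_0_iff_dvd)
      moreover have "gcd (p - [:u:]) (q - [:v:]) \<noteq> 0"
        using degm[OF deg(1), of u] deg by auto
      ultimately have "degree [:-\<xi>, 1:] \<le> degree (gcd (p - [:u:]) (q - [:v:]))"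
        by (rule dvd_imp_degree_le)
      then show "degree (gcd (p - [:u:]) (q - [:v:])) \<noteq> 0" by simp
    qed
    finally show ?thesis by simp
  qed
  then have "range (\<lambda>\<xi>. (poly p \<xi>, poly q \<xi>)) = zero_set {resultant f g}"
    by (auto simp: zero_set_def)
  then show ?thesis by (auto simp: algebraic_set_def)
qed

lemma eval2_on_polynomial_curve:
  obtains h where "\<And>\<xi>. eval2 F (poly p \<xi>) (poly q \<xi>) = poly h \<xi>"
proof -
  have "\<exists>h. \<forall>\<xi>. eval2 F (poly p \<xi>) (poly q \<xi>) = poly h \<xi>"
  proof (induction F)
    case 0
    show ?case by (intro exI[of _ 0]) simp
  next
    case (pCons c F)
    then obtain h where "\<forall>\<xi>. eval2 F (poly p \<xi>) (poly q \<xi>) = poly h \<xi>" by blast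
    then show ?case by (intro exI[of _ "pcompose c p + q * h"]) (simp add: poly_pcompose)
  qed
  with that show ?thesis by blast
qed

text \<open>Equations pull back along the parametrization to C[\<xi>], an integral domain: if the
  curve were covered by two proper algebraic parts, two nonzero polynomials would have product
  0.\<close>

lemma irreducible_alg_polynomial_curve:
  fixes p q :: "complex poly"
  assumes "degree p > 0" "degree q > 0"
  shows "irreducible_alg (range (\<lambda>\<xi>. (poly p \<xi>, poly q \<xi>)))" (is "irreducible_alg ?X")
  unfolding irreducible_alg_def
proof (intro conjI allI impI)
  show "algebraic_set ?X" using assms by (rule algebraic_set_polynomial_curve)
  show "?X \<noteq> {}" by simp
next
  fix Y Z assume "algebraic_set Y \<and> algebraic_set Z \<and> ?X = Y \<union> Z"
  then obtain S T where Y: "Y = zero_set S" and Z: "Z = zero_set T" and X: "?X = Y \<union> Z"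
    by (auto simp: algebraic_set_def)
  show "?X = Y \<or> ?X = Z"
  proof (rule ccontr)
    assume "\<not> ?thesis"
    then have "\<not> ?X \<subseteq> Y" "\<not> ?X \<subseteq> Z"
      using X by auto
    then obtain \<xi>1 \<xi>2 where "(poly p \<xi>1, poly q \<xi>1) \<notin> Y" "(poly p \<xi>2, poly q \<xi>2) \<notin> Z"
      by auto
    then obtain f g where fg: "f \<in> S" "g \<in> T"
      "eval2 f (poly p \<xi>1) (poly q \<xi>1) \<noteq> 0" "eval2 g (poly p \<xi>2) (poly q \<xi>2) \<noteq> 0"
      unfolding Y Z zero_set_def by auto
    obtain a where a: "\<And>\<xi>. eval2 f (poly p \<xi>) (poly q \<xi>) = poly a \<xi>"
      using eval2_on_polynomial_curve by blast
    obtain b where b: "\<And>\<xi>. eval2 g (poly p \<xi>) (poly q \<xi>) = poly b \<xi>"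
      using eval2_on_polynomial_curve by blast
    have "poly (a * b) \<xi> = 0" for \<xi>
    proof -
      have "(poly p \<xi>, poly q \<xi>) \<in> ?X" by simp
      then have "(poly p \<xi>, poly q \<xi>) \<in> Y \<union> Z" unfolding X .
      then have "eval2 f (poly p \<xi>) (poly q \<xi>) = 0 \<or> eval2 g (poly p \<xi>) (poly q \<xi>) = 0"
        using fg(1,2) unfolding Y Z zero_set_def by blast
      then show ?thesis by (auto simp: a b)
    qed
    then have "a * b = 0" using poly_all_0_iff_0 by blast
    then show False using fg(3,4) unfolding a b by auto
  qed
qed

subsection \<open>Charts at infinity and Newton polygon steps\<close>

text \<open>In the coordinates \<open>x = X(s)\<close>, \<open>y = \<Phi>(s) + Z(s) \<xi>\<close> the map \<open>(P, Q)\<close> becomes \<open>(F / s\<^sup>a, G / s\<^sup>b)\<close>;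
  infinity corresponds to \<open>s \<rightarrow> 0\<close>.\<close>

definition in_chart :: "bipoly \<Rightarrow> bipoly \<Rightarrow> nat \<Rightarrow> nat \<Rightarrow> bipoly \<Rightarrow> bipoly \<Rightarrow> bool" where
  "in_chart P Q a b F G \<longleftrightarrow> (\<exists>X \<Phi> Z.
     (\<forall>s. s \<noteq> 0 \<longrightarrow> X field_differentiable at s \<and> \<Phi> field_differentiable at s \<and> Z field_differentiable at s) \<and>
     (\<forall>s \<xi>. s \<noteq> 0 \<longrightarrow> eval2 F s \<xi> = s ^ a * eval2 P (X s) (\<Phi> s + Z s * \<xi>) \<and>
                     eval2 G s \<xi> = s ^ b * eval2 Q (X s) (\<Phi> s + Z s * \<xi>)))"

text \<open>The s-derivative is multiplied by s so that the term a s^(a - 1) turns into a multiple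
  of F, uniformly including a = 0.\<close>

lemma in_chart_partial_derivatives:
  assumes X: "(X has_field_derivative X') (at s)" and \<Phi>: "(\<Phi> has_field_derivative \<Phi>') (at s)"
    and Z: "(Z has_field_derivative Z') (at s)" and s: "s \<noteq> 0"
    and F: "\<And>s \<xi>. s \<noteq> 0 \<Longrightarrow> eval2 F s \<xi> = s ^ a * eval2 P (X s) (\<Phi> s + Z s * \<xi>)"
  shows "eval2 (dy F) s \<xi> = s ^ a * (eval2 (dy P) (X s) (\<Phi> s + Z s * \<xi>) * Z s)"
    and "s * eval2 (dx F) s \<xi> = of_nat a * eval2 F s \<xi> + s * s ^ a *
           (eval2 (dx P) (X s) (\<Phi> s + Z s * \<xi>) * X' + eval2 (dy P) (X s) (\<Phi> s + Z s * \<xi>) * (\<Phi>' + Z' * \<xi>))"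
proof -
  let ?y = "\<Phi> s + Z s * \<xi>"
  have "((\<lambda>\<xi>. eval2 F s \<xi>) has_field_derivative eval2 (dy F) s \<xi>) (at \<xi>)"
    using has_field_derivative_eval2[of "\<lambda>_. s" 0 \<xi> "\<lambda>\<xi>. \<xi>" 1 F] by simp
  moreover have "((\<lambda>\<xi>. eval2 F s \<xi>) has_field_derivative s ^ a * (eval2 (dy P) (X s) ?y * Z s)) (at \<xi>)"
  proof -
    have "((\<lambda>\<xi>. \<Phi> s + Z s * \<xi>) has_field_derivative Z s) (at \<xi>)"
      by (auto intro!: derivative_eq_intros)
    from DERIV_cmult[OF has_field_derivative_eval2[OF DERIV_const[of "X s"] this, of P], of "s ^ a"]
    show ?thesis using F[OF s] by simp
  qed
  ultimately show "eval2 (dy F) s \<xi> = s ^ a * (eval2 (dy P) (X s) ?y * Z s)"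
    by (rule DERIV_unique)
  define D where "D = eval2 (dx P) (X s) ?y * X' + eval2 (dy P) (X s) ?y * (\<Phi>' + Z' * \<xi>)"
  have "((\<lambda>s. eval2 F s \<xi>) has_field_derivative eval2 (dx F) s \<xi>) (at s)"
    using has_field_derivative_eval2[of "\<lambda>s. s" 1 s "\<lambda>_. \<xi>" 0 F] by simp
  moreover have "((\<lambda>s. eval2 F s \<xi>) has_field_derivative
      of_nat a * s ^ (a - 1) * eval2 P (X s) ?y + s ^ a * D) (at s)"
  \<comment> \<open>The chart identity holds only for s different from 0, so the two functions are
    compared on the punctured plane.\<close>
  proof (rule has_field_derivative_transform_within_open)
    have "((\<lambda>s. \<Phi> s + Z s * \<xi>) has_field_derivative \<Phi>' + Z' * \<xi>) (at s)"
      by (auto intro!: derivative_eq_intros \<Phi> Z)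
    from has_field_derivative_eval2[OF X this, of P]
    have D: "((\<lambda>s. eval2 P (X s) (\<Phi> s + Z s * \<xi>)) has_field_derivative D) (at s)"
      by (simp add: D_def)
    have pow: "((\<lambda>s. s ^ a) has_field_derivative of_nat a * s ^ (a - 1)) (at s)"
      by (auto intro!: derivative_eq_intros)
    show "((\<lambda>s. s ^ a * eval2 P (X s) (\<Phi> s + Z s * \<xi>)) has_field_derivative
      of_nat a * s ^ (a - 1) * eval2 P (X s) ?y + s ^ a * D) (at s)"
      by (rule DERIV_cong[OF DERIV_mult[OF pow D]]) (simp add: ac_simps)
    show "open (- {0::complex})" by (intro open_Compl closed_singleton)
    show "s \<in> - {0}" using s by simp
    show "t ^ a * eval2 P (X t) (\<Phi> t + Z t * \<xi>) = eval2 F t \<xi>" if "t \<in> - {0}" for t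
      using F that by simp
  qed
  ultimately have "eval2 (dx F) s \<xi> = of_nat a * s ^ (a - 1) * eval2 P (X s) ?y + s ^ a * D"
    by (rule DERIV_unique)
  then have "s * eval2 (dx F) s \<xi> = of_nat a * (s * s ^ (a - 1) * eval2 P (X s) ?y) + s * s ^ a * D"
    by (simp add: algebra_simps)
  also have "of_nat a * (s * s ^ (a - 1) * eval2 P (X s) ?y) = of_nat a * eval2 F s \<xi>"
    using F[OF s, of \<xi>] by (cases a) auto
  finally show "s * eval2 (dx F) s \<xi> = of_nat a * eval2 F s \<xi> + s * s ^ a * D" .
qed

text \<open>The constant Jacobian makes the Jacobian in the coordinates \<open>(s, \<xi>)\<close> independent of \<open>\<xi>\<close>;
  this survives the limit \<open>s \<rightarrow> 0\<close>.\<close>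

lemma in_chart_wronskian:
  assumes chart: "in_chart P Q a b F G" and jac: "jacobian P Q = [:[:c:]:]"
  shows "of_nat a * poly (special F) \<xi> * poly (pderiv (special G)) \<xi>
           - of_nat b * poly (special G) \<xi> * poly (pderiv (special F)) \<xi> =
         of_nat a * poly (special F) \<zeta> * poly (pderiv (special G)) \<zeta>
           - of_nat b * poly (special G) \<zeta> * poly (pderiv (special F)) \<zeta>"
proof -
  \<comment> \<open>The terms with a and b remove the derivatives of s^a and s^b. Up to powers of s,
    E is minus the Jacobian determinant of (P, Q) in the coordinates (s, \<xi>), but it also makes
    sense at s = 0.\<close>
  define E where "E s \<xi> = (of_nat a * eval2 F s \<xi> - s * eval2 (dx F) s \<xi>) * eval2 (dy G) s \<xi>
                         - (of_nat b * eval2 G s \<xi> - s * eval2 (dx G) s \<xi>) * eval2 (dy F) s \<xi>" for s \<xi>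
  obtain X \<Phi> Z where diff: "\<And>s. s \<noteq> 0 \<Longrightarrow> X field_differentiable at s"
      "\<And>s. s \<noteq> 0 \<Longrightarrow> \<Phi> field_differentiable at s" "\<And>s. s \<noteq> 0 \<Longrightarrow> Z field_differentiable at s"
    and F: "\<And>s \<xi>. s \<noteq> 0 \<Longrightarrow> eval2 F s \<xi> = s ^ a * eval2 P (X s) (\<Phi> s + Z s * \<xi>)"
    and G: "\<And>s \<xi>. s \<noteq> 0 \<Longrightarrow> eval2 G s \<xi> = s ^ b * eval2 Q (X s) (\<Phi> s + Z s * \<xi>)"
    using chart unfolding in_chart_def by blast
  have E_indep: "E s \<xi> = E s \<zeta>" if s: "s \<noteq> 0" for s \<xi> \<zeta>
  proof -
    obtain X' \<Phi>' Z' where D: "(X has_field_derivative X') (at s)" "(\<Phi> has_field_derivative \<Phi>') (at s)"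
      "(Z has_field_derivative Z') (at s)"
      using diff[OF s] unfolding field_differentiable_def by blast
    \<comment> \<open>The two terms with W carry the same product P_y Q_y and cancel. The factor
      \<open>Z s\<close> is free of \<xi> because the chart is affine in \<xi>.\<close>
    have "E s \<xi> = - (s * s ^ a * s ^ b * X' * Z s * c)" for \<xi>
    proof -
      define x y W where "x = X s" and "y = \<Phi> s + Z s * \<xi>" and "W = \<Phi>' + Z' * \<xi>"
      have "eval2 (jacobian P Q) x y = c" by (simp add: jac)
      then have c: "c = eval2 (dx P) x y * eval2 (dy Q) x y - eval2 (dy P) x y * eval2 (dx Q) x y"
        by (simp add: jacobian_def eval2_diff eval2_mult)
      have dF: "eval2 (dy F) s \<xi> = s ^ a * (eval2 (dy P) x y * Z s)"
        "s * eval2 (dx F) s \<xi> = of_nat a * eval2 F s \<xi> + s * s ^ a * (eval2 (dx P) x y * X' + eval2 (dy P) x y * W)"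
        unfolding x_def y_def W_def 
        by (intro in_chart_partial_derivatives(1)[OF D s] in_chart_partial_derivatives(2)[OF D s] F; assumption)+
      have dG: "eval2 (dy G) s \<xi> = s ^ b * (eval2 (dy Q) x y * Z s)"
        "s * eval2 (dx G) s \<xi> = of_nat b * eval2 G s \<xi> + s * s ^ b * (eval2 (dx Q) x y * X' + eval2 (dy Q) x y * W)"
        unfolding x_def y_def W_def 
        by (intro in_chart_partial_derivatives(1)[OF D s] in_chart_partial_derivatives(2)[OF D s] G; assumption)+
      show ?thesis unfolding E_def dF dG c by (simp add: algebra_simps)
    qed
    then show ?thesis by simp
  qed
  have lim: "(\<lambda>n. E (1 / of_nat (Suc n)) \<xi>) \<longlonglongrightarrow> E 0 \<xi>" for \<xi>
  proof -
    have "(\<lambda>n. 1 / of_nat (Suc n) :: complex) \<longlonglongrightarrow> 0"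
      by (rule LIMSEQ_Suc[OF lim_1_over_n])
    then show ?thesis unfolding E_def by (intro tendsto_intros)
  qed
  have "E 0 \<xi> = E 0 \<zeta>"
  proof (rule LIMSEQ_unique[OF lim])
    have "E (1 / of_nat (Suc n)) \<xi> = E (1 / of_nat (Suc n)) \<zeta>" for n
      by (intro E_indep) (simp del: of_nat_Suc)
    then show "(\<lambda>n. E (1 / of_nat (Suc n)) \<xi>) \<longlonglongrightarrow> E 0 \<zeta>"
      using lim[of \<zeta>] by simp
  qed
  then show ?thesis
    by (simp add: E_def poly_special poly_pderiv_special)
qed

lemma in_chart_translate_y:
  assumes "in_chart P Q a b F G"
  shows "in_chart P Q a b (translate_y c F) (translate_y c G)"
proof -
  obtain X \<Phi> Z where diff: "\<And>s. s \<noteq> 0 \<Longrightarrow> X field_differentiable at s \<and> \<Phi> field_differentiable at s \<and> Z field_differentiable at s"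
    and FG: "\<And>s \<xi>. s \<noteq> 0 \<Longrightarrow> eval2 F s \<xi> = s ^ a * eval2 P (X s) (\<Phi> s + Z s * \<xi>) \<and>
                     eval2 G s \<xi> = s ^ b * eval2 Q (X s) (\<Phi> s + Z s * \<xi>)"
    using assms unfolding in_chart_def by blast
  show ?thesis unfolding in_chart_def
  proof (rule exI[of _ X], rule exI[of _ "\<lambda>s. \<Phi> s + Z s * c"], rule exI[of _ Z], intro conjI allI impI)
    fix s :: complex assume "s \<noteq> 0"
    with diff show "(\<lambda>s. \<Phi> s + Z s * c) field_differentiable at s"
      by (intro field_differentiable_add field_differentiable_mult field_differentiable_const) auto
  qed (use diff FG in \<open>auto simp: algebra_simps\<close>)
qed

section \<open>Newton polygons and weighted blow-ups\<close>

text \<open>The support lies on or above the line through (0, n) on which i / (n - j) = l / k;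
  multiplying out avoids fractions and negative differences.\<close>

definition above_slope :: "nat \<Rightarrow> nat \<Rightarrow> nat \<Rightarrow> bipoly \<Rightarrow> bool" where
  "above_slope k l n F \<longleftrightarrow> (\<forall>i j. coeff (coeff F j) i \<noteq> 0 \<longrightarrow> l * n \<le> k * i + l * j)"

text \<open>The substitution \<open>s \<mapsto> s\<^sup>k\<close>, \<open>\<xi> \<mapsto> s\<^sup>l \<xi>\<close> followed by division by \<open>s\<^bsup>l n\<^esup>\<close>. The subtraction is
  truncated, hence meaningful only for \<open>above_slope k l n F\<close>.\<close>

definition blowup :: "nat \<Rightarrow> nat \<Rightarrow> nat \<Rightarrow> bipoly \<Rightarrow> bipoly" where
  "blowup k l n F = reweight (\<lambda>i j. k * i + l * j - l * n) F"

lemma eval2_blowup: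
  assumes "above_slope k l n F" "s \<noteq> 0"
  shows "eval2 (blowup k l n F) s \<xi> = eval2 F (s ^ k) (s ^ l * \<xi>) / s ^ (l * n)"
proof -
  have "eval2 (blowup k l n F) s \<xi> = inverse (s ^ (l * n)) * eval2 F (s ^ k) (s ^ l * \<xi>)"
    unfolding blowup_def
  proof (rule eval2_reweight)
    fix i j assume "coeff (coeff F j) i \<noteq> 0"
    then have "l * n \<le> k * i + l * j" using assms by (auto simp: above_slope_def)
    then have "s ^ (k * i + l * j - l * n) = s ^ (k * i + l * j) / s ^ (l * n)"
      using assms(2) by (intro power_diff) auto
    moreover have "(s ^ k) ^ i = s ^ (k * i)" "(s ^ l * \<xi>) ^ j = s ^ (l * j) * \<xi> ^ j"
      by (simp_all add: power_mult power_mult_distrib)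
    ultimately show "s ^ (k * i + l * j - l * n) * \<xi> ^ j = inverse (s ^ (l * n)) * (s ^ k) ^ i * (s ^ l * \<xi>) ^ j"
      by (simp add: power_add divide_inverse)
  qed
  then show ?thesis by (simp add: field_simps)
qed

text \<open>On s = 0 the blow-up is the edge polynomial of the Newton polygon: row j keeps only its
  point on the supporting line, unique since k > 0.\<close>

lemma coeff_special_blowup:
  assumes "above_slope k l n F" "k > 0" "k * i + l * j = l * n"
  shows "coeff (special (blowup k l n F)) j = coeff (coeff F j) i"
  unfolding blowup_def
proof (rule coeff_special_reweight)
  fix i' assume "coeff (coeff F j) i' \<noteq> 0"
  then have "l * n \<le> k * i' + l * j" using assms by (auto simp: above_slope_def)
  then have "k * i' + l * j - l * n = 0 \<longleftrightarrow> k * i' = k * i"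
    using assms(3) by linarith
  then show "k * i' + l * j - l * n = 0 \<longleftrightarrow> i' = i" using assms(2) by simp
qed

lemma coeff_special_blowup_nonzero:
  assumes "above_slope k l n F" "coeff (special (blowup k l n F)) j \<noteq> 0"
  obtains i where "coeff (coeff F j) i \<noteq> 0" "k * i + l * j = l * n"
proof -
  obtain i where i: "coeff (coeff F j) i \<noteq> 0" "k * i + l * j - l * n = 0"
    using assms(2) unfolding blowup_def by (rule coeff_special_reweight_nonzero)
  then have "l * n \<le> k * i + l * j" using assms(1) by (auto simp: above_slope_def)
  with i that show ?thesis by force
qed

text \<open>The point (0, n) lies on the supporting line, and rows j > n lie strictly above it
  because l > 0.\<close>

lemma special_blowup_leading:
  assumes "above_slope k l n F" "k > 0" "l > 0" "poly (coeff F n) 0 \<noteq> 0"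
  shows "degree (special (blowup k l n F)) = n" "lead_coeff (special (blowup k l n F)) = poly (coeff F n) 0"
proof -
  have n: "coeff (special (blowup k l n F)) n = poly (coeff F n) 0"
    using coeff_special_blowup[OF assms(1,2), of 0 n] by (simp add: poly_0_coeff_0)
  show d: "degree (special (blowup k l n F)) = n"
  proof (rule antisym)
    show "degree (special (blowup k l n F)) \<le> n"
    proof (intro degree_le allI impI)
      fix j assume "n < j"
      then have "l * n < k * i + l * j" for i using assms(3) by (simp add: trans_less_add2)
      then show "coeff (special (blowup k l n F)) j = 0"
        using coeff_special_blowup_nonzero[OF assms(1), of j] by (metis less_irrefl)
    qed
    show "n \<le> degree (special (blowup k l n F))" using n assms(4) by (intro le_degree) simp
  qed
  show "lead_coeff (special (blowup k l n F)) = poly (coeff F n) 0" using n d by simp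
qed

lemma in_chart_blowup:
  assumes chart: "in_chart P Q a b F G" and F: "above_slope k l n F" and G: "above_slope k l n' G"
    and le: "l * n \<le> k * a" "l * n' \<le> k * b"
  shows "in_chart P Q (k * a - l * n) (k * b - l * n') (blowup k l n F) (blowup k l n' G)"
proof -
  obtain X \<Phi> Z where diff: "\<And>s. s \<noteq> 0 \<Longrightarrow> X field_differentiable at s \<and> \<Phi> field_differentiable at s \<and> Z field_differentiable at s"
    and FG: "\<And>s \<xi>. s \<noteq> 0 \<Longrightarrow> eval2 F s \<xi> = s ^ a * eval2 P (X s) (\<Phi> s + Z s * \<xi>) \<and>
                     eval2 G s \<xi> = s ^ b * eval2 Q (X s) (\<Phi> s + Z s * \<xi>)"
    using chart unfolding in_chart_def by blast
  show ?thesis unfolding in_chart_def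
  proof (rule exI[of _ "\<lambda>s. X (s ^ k)"], rule exI[of _ "\<lambda>s. \<Phi> (s ^ k)"],
      rule exI[of _ "\<lambda>s. Z (s ^ k) * s ^ l"], intro conjI allI impI)
    fix s :: complex assume s: "s \<noteq> 0"
    have comp: "(\<lambda>s. g (s ^ k)) field_differentiable at s" if "g field_differentiable at (s ^ k)" for g
      using field_differentiable_compose[of "\<lambda>s. s ^ k" s g] that
      by (simp add: o_def field_differentiable_power)
    show "(\<lambda>s. X (s ^ k)) field_differentiable at s" "(\<lambda>s. \<Phi> (s ^ k)) field_differentiable at s"
      using diff[of "s ^ k"] s by (auto intro: comp)
    show "(\<lambda>s. Z (s ^ k) * s ^ l) field_differentiable at s"
      using diff[of "s ^ k"] s by (intro field_differentiable_mult comp) (auto simp: field_differentiable_power)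
    show "eval2 (blowup k l n F) s \<xi> = s ^ (k * a - l * n) * eval2 P (X (s ^ k)) (\<Phi> (s ^ k) + Z (s ^ k) * s ^ l * \<xi>)" for \<xi>
      using FG[of "s ^ k" "s ^ l * \<xi>"] s le by (simp add: eval2_blowup[OF F s] power_diff power_mult mult.assoc)
    show "eval2 (blowup k l n' G) s \<xi> = s ^ (k * b - l * n') * eval2 Q (X (s ^ k)) (\<Phi> (s ^ k) + Z (s ^ k) * s ^ l * \<xi>)" for \<xi>
      using FG[of "s ^ k" "s ^ l * \<xi>"] s le by (simp add: eval2_blowup[OF G s] power_diff power_mult mult.assoc)
  qed
qed

section \<open>Limit values over a point of s = 0\<close>

text \<open>Formulated with sequences so that a change of chart becomes an equality of sets; the
  only analytic point left is that the new coordinate stays bounded.\<close>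

definition limit_values :: "nat \<Rightarrow> nat \<Rightarrow> bipoly \<Rightarrow> bipoly \<Rightarrow> complex \<Rightarrow> (complex \<times> complex) set" where
  "limit_values a b F G c = {(u, v). \<exists>s \<xi>. (\<forall>i. s i \<noteq> 0) \<and> s \<longlonglongrightarrow> 0 \<and> \<xi> \<longlonglongrightarrow> c \<and>
     (\<lambda>i. eval2 F (s i) (\<xi> i) / s i ^ a) \<longlonglongrightarrow> u \<and> (\<lambda>i. eval2 G (s i) (\<xi> i) / s i ^ b) \<longlonglongrightarrow> v}"

lemma limit_valuesI:
  assumes "\<And>i. s i \<noteq> 0" "s \<longlonglongrightarrow> 0" "\<xi> \<longlonglongrightarrow> c"
    "(\<lambda>i. eval2 F (s i) (\<xi> i) / s i ^ a) \<longlonglongrightarrow> u" "(\<lambda>i. eval2 G (s i) (\<xi> i) / s i ^ b) \<longlonglongrightarrow> v"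
  shows "(u, v) \<in> limit_values a b F G c"
  using assms unfolding limit_values_def by blast

lemma limit_valuesE:
  assumes "(u, v) \<in> limit_values a b F G c"
  obtains s \<xi> where "\<forall>i. s i \<noteq> 0" "s \<longlonglongrightarrow> 0" "\<xi> \<longlonglongrightarrow> c"
    "(\<lambda>i. eval2 F (s i) (\<xi> i) / s i ^ a) \<longlonglongrightarrow> u" "(\<lambda>i. eval2 G (s i) (\<xi> i) / s i ^ b) \<longlonglongrightarrow> v"
proof -
  have "\<exists>s \<xi>. (\<forall>i. s i \<noteq> 0) \<and> s \<longlonglongrightarrow> 0 \<and> \<xi> \<longlonglongrightarrow> c \<and>
     (\<lambda>i. eval2 F (s i) (\<xi> i) / s i ^ a) \<longlonglongrightarrow> u \<and> (\<lambda>i. eval2 G (s i) (\<xi> i) / s i ^ b) \<longlonglongrightarrow> v"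
    using assms by (simp add: limit_values_def)
  then show ?thesis by (elim exE conjE) (rule that; simp)
qed

lemma limit_values_translate_y:
  "limit_values a b F G c = limit_values a b (translate_y c F) (translate_y c G) 0"
proof (intro Set.equalityI Set.subsetI; clarify)
  fix u v assume "(u, v) \<in> limit_values a b F G c"
  then obtain s \<xi> where *: "\<forall>i. s i \<noteq> 0" "s \<longlonglongrightarrow> 0" "\<xi> \<longlonglongrightarrow> c"
    "(\<lambda>i. eval2 F (s i) (\<xi> i) / s i ^ a) \<longlonglongrightarrow> u" "(\<lambda>i. eval2 G (s i) (\<xi> i) / s i ^ b) \<longlonglongrightarrow> v"
    by (rule limit_valuesE)
  show "(u, v) \<in> limit_values a b (translate_y c F) (translate_y c G) 0"
    by (rule limit_valuesI[of s "\<lambda>i. \<xi> i - c"]) (use * in \<open>auto simp: LIM_zero_iff\<close>)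
next
  fix u v assume "(u, v) \<in> limit_values a b (translate_y c F) (translate_y c G) 0"
  then obtain s \<xi> where *: "\<forall>i. s i \<noteq> 0" "s \<longlonglongrightarrow> 0" "\<xi> \<longlonglongrightarrow> 0"
    "(\<lambda>i. eval2 (translate_y c F) (s i) (\<xi> i) / s i ^ a) \<longlonglongrightarrow> u"
    "(\<lambda>i. eval2 (translate_y c G) (s i) (\<xi> i) / s i ^ b) \<longlonglongrightarrow> v"
    by (rule limit_valuesE)
  show "(u, v) \<in> limit_values a b F G c"
    by (rule limit_valuesI[of s "\<lambda>i. \<xi> i + c"])
       (use * tendsto_add[OF *(3) tendsto_const[of c]] in auto)
qed

lemma limit_values_zero_exponents:
  "limit_values 0 0 F G c = {(poly (special F) c, poly (special G) c)}"
proof (intro Set.equalityI Set.subsetI)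
  fix z assume z: "z \<in> limit_values 0 0 F G c"
  obtain u v where uv: "z = (u, v)" by (cases z)
  obtain s \<xi> where *: "s \<longlonglongrightarrow> 0" "\<xi> \<longlonglongrightarrow> c"
    "(\<lambda>i. eval2 F (s i) (\<xi> i)) \<longlonglongrightarrow> u" "(\<lambda>i. eval2 G (s i) (\<xi> i)) \<longlonglongrightarrow> v"
    using z unfolding uv limit_values_def by auto
  have "u = eval2 F 0 c" "v = eval2 G 0 c"
    using * tendsto_eval2[OF *(1,2)] LIMSEQ_unique by blast+
  then show "z \<in> {(poly (special F) c, poly (special G) c)}"
    by (simp add: uv poly_special)
next
  fix z assume z: "z \<in> {(poly (special F) c, poly (special G) c)}"
  have s: "(\<lambda>n. 1 / of_nat (Suc n) :: complex) \<longlonglongrightarrow> 0"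
    by (rule LIMSEQ_Suc[OF lim_1_over_n])
  have "(eval2 F 0 c, eval2 G 0 c) \<in> limit_values 0 0 F G c"
    by (rule limit_valuesI[OF _ s tendsto_const])
       (use tendsto_eval2[OF s tendsto_const[of c]] in \<open>auto simp del: of_nat_Suc\<close>)
  with z show "z \<in> limit_values 0 0 F G c" by (simp add: poly_special)
qed

text \<open>Multiplying the convergent quotient by a positive power of s, which tends to 0, shows
  that the numerator tends to 0.\<close>

lemma limit_values_roots:
  assumes "(u, v) \<in> limit_values a b F G c" "a > 0" "b > 0"
  shows "poly (special F) c = 0" "poly (special G) c = 0"
proof -
  obtain s \<xi> where *: "\<forall>i. s i \<noteq> 0" "s \<longlonglongrightarrow> 0" "\<xi> \<longlonglongrightarrow> c"
    "(\<lambda>i. eval2 F (s i) (\<xi> i) / s i ^ a) \<longlonglongrightarrow> u" "(\<lambda>i. eval2 G (s i) (\<xi> i) / s i ^ b) \<longlonglongrightarrow> v"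
    using assms(1) by (rule limit_valuesE)
  have "eval2 H 0 c = 0" if "(\<lambda>i. eval2 H (s i) (\<xi> i) / s i ^ n) \<longlonglongrightarrow> w" "n > 0" for H n w
  proof -
    have "(\<lambda>i. eval2 H (s i) (\<xi> i) / s i ^ n * s i ^ n) \<longlonglongrightarrow> w * 0 ^ n"
      by (intro tendsto_intros that *)
    then have "(\<lambda>i. eval2 H (s i) (\<xi> i)) \<longlonglongrightarrow> 0" using *(1) that(2) by (simp add: zero_power)
    then show ?thesis using tendsto_eval2[OF *(2,3)] LIMSEQ_unique by blast
  qed
  then show "poly (special F) c = 0" "poly (special G) c = 0"
    using *(4,5) assms(2,3) by (auto simp: poly_special)
qed

lemma limit_values_subsequence:
  assumes s: "\<And>i. s i \<noteq> 0" "s \<longlonglongrightarrow> 0" and \<xi>: "Bseq \<xi>"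
    and lim: "(\<lambda>i. eval2 F (s i) (\<xi> i) / s i ^ a) \<longlonglongrightarrow> u" "(\<lambda>i. eval2 G (s i) (\<xi> i) / s i ^ b) \<longlonglongrightarrow> v"
  obtains c where "(u, v) \<in> limit_values a b F G c"
proof -
  have "bounded (range \<xi>)" using \<xi> by (simp add: Bseq_eq_bounded)
  then obtain c r where r: "strict_mono r" "(\<xi> \<circ> r) \<longlonglongrightarrow> c"
    using bounded_imp_convergent_subsequence by blast
  have "(u, v) \<in> limit_values a b F G c"
    by (rule limit_valuesI[of "s \<circ> r" "\<xi> \<circ> r"])
       (use s r LIMSEQ_subseq_LIMSEQ[OF s(2) r(1)] LIMSEQ_subseq_LIMSEQ[OF lim(1) r(1)]
          LIMSEQ_subseq_LIMSEQ[OF lim(2) r(1)] in \<open>auto simp: o_def\<close>)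
  then show ?thesis by (rule that)
qed

text \<open>The blow-up may have rows above n whose coefficients vanish at s = 0, so its own leading
  coefficient is of no help. Since the old coordinate \<xi> tends to 0, all rows j \<ge> n can be
  collected into g z^n, where g tends to the nonzero value of row n. What remains is a polynomial of
  degree n in the new coordinate z.\<close>

lemma Bseq_blowup_coordinate:
  assumes F: "above_slope k l n F" and kl: "k > 0" "l > 0" "n > 0" and lead: "poly (coeff F n) 0 \<noteq> 0"
    and t: "\<And>i. t i \<noteq> 0" "t \<longlonglongrightarrow> 0" and \<xi>: "\<xi> \<longlonglongrightarrow> 0"
    and val: "Bseq (\<lambda>i. eval2 (blowup k l n F) (t i) (\<xi> i / t i ^ l))"
  shows "Bseq (\<lambda>i. \<xi> i / t i ^ l)"
proof -
  define N where "N = degree F"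
  have nN: "n \<le> N" unfolding N_def using lead by (intro le_degree) auto
  define z where "z i = \<xi> i / t i ^ l" for i
  define B where "B = blowup k l n F"
  define g where "g i = (\<Sum>j\<in>{n..N}. poly (coeff F j) (t i ^ k) * \<xi> i ^ (j - n))" for i
  define c where "c j i = (if j = n then g i else poly (coeff B j) (t i))" for j i
  have tk: "(\<lambda>i. t i ^ k) \<longlonglongrightarrow> 0"
    using tendsto_power[OF t(2), of k] kl by (simp add: zero_power)
  have upper: "poly (coeff B j) (t i) * z i ^ j = poly (coeff F j) (t i ^ k) * \<xi> i ^ (j - n) * z i ^ n"
    if j: "n \<le> j" for i j
  proof -
    have "poly (coeff B j) (t i) = t i ^ (l * (j - n)) * poly (coeff F j) (t i ^ k)"
      unfolding B_def blowup_def
    proof (rule poly_coeff_reweight)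
      fix i'
      have "k * i' + l * j - l * n = l * (j - n) + k * i'"
        using j by (simp add: diff_mult_distrib2)
      then show "t i ^ (k * i' + l * j - l * n) = t i ^ (l * (j - n)) * (t i ^ k) ^ i'"
        by (simp add: power_add power_mult)
    qed
    moreover have "\<xi> i = t i ^ l * z i" using t(1)[of i] by (simp add: z_def)
    moreover have "z i ^ j = z i ^ (j - n) * z i ^ n" using j by (simp flip: power_add)
    ultimately show ?thesis by (simp add: power_mult power_mult_distrib)
  qed
  have "Bseq z"
  proof (rule Bseq_polynomial_argument[of n c])
    show "n > 0" by fact
    have "g \<longlonglongrightarrow> (\<Sum>j\<in>{n..N}. poly (coeff F j) 0 * 0 ^ (j - n))"
      unfolding g_def by (intro tendsto_intros tk \<xi>)
    also have "(\<Sum>j\<in>{n..N}. poly (coeff F j) 0 * 0 ^ (j - n)) = (\<Sum>j\<in>{n..N}. if j = n then poly (coeff F n) 0 else 0)"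
      by (intro sum.cong refl) (auto simp: zero_power)
    also have "\<dots> = poly (coeff F n) 0" using nN by simp
    finally show "c n \<longlonglongrightarrow> poly (coeff F n) 0"
      by (subst (asm) tendsto_cong[of g "c n"]) (simp_all add: c_def)
    show "poly (coeff F n) 0 \<noteq> 0" by fact
    show "Bseq (c j)" if "j < n" for j
    proof -
      have "(\<lambda>i. poly (coeff B j) (t i)) \<longlonglongrightarrow> poly (coeff B j) 0"
        by (intro tendsto_intros t)
      then show ?thesis using that unfolding c_def by (auto intro: convergent_imp_Bseq convergentI)
    qed
    have "(\<Sum>j\<le>n. c j i * z i ^ j) = eval2 B (t i) (z i)" for i
    proof -
      have "degree B \<le> N" unfolding B_def blowup_def N_def by (rule degree_reweight_le)
      then have "eval2 B (t i) (z i) = (\<Sum>j\<le>N. poly (coeff B j) (t i) * z i ^ j)"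
        by (rule eval2_as_sum)
      also have "{..N} = {..<n} \<union> {n..N}" using nN by auto
      also have "(\<Sum>j\<in>{..<n} \<union> {n..N}. poly (coeff B j) (t i) * z i ^ j) =
          (\<Sum>j<n. poly (coeff B j) (t i) * z i ^ j) + (\<Sum>j\<in>{n..N}. poly (coeff B j) (t i) * z i ^ j)"
        by (rule sum.union_disjoint) auto
      also have "(\<Sum>j\<in>{n..N}. poly (coeff B j) (t i) * z i ^ j) = g i * z i ^ n"
        unfolding g_def sum_distrib_right by (intro sum.cong refl upper) auto
      also have "(\<Sum>j<n. poly (coeff B j) (t i) * z i ^ j) = (\<Sum>j<n. c j i * z i ^ j)"
        by (intro sum.cong refl) (auto simp: c_def)
      finally show ?thesis by (simp add: c_def flip: lessThan_Suc_atMost)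
    qed
    then show "Bseq (\<lambda>i. \<Sum>j\<le>n. c j i * z i ^ j)"
      using val by (simp add: B_def z_def)
  qed
  then show ?thesis by (simp add: z_def[abs_def])
qed

lemma blowup_quotient:
  assumes "above_slope k l n F" "s \<noteq> 0" "l * n \<le> k * a"
  shows "eval2 (blowup k l n F) s \<xi> / s ^ (k * a - l * n) = eval2 F (s ^ k) (s ^ l * \<xi>) / (s ^ k) ^ a"
  using assms by (simp add: eval2_blowup power_diff power_mult)

lemma limit_values_blowup:
  assumes F: "above_slope k l n F" and G: "above_slope k l n' G" and kl: "k > 0" "l > 0" "n > 0"
    and lead: "poly (coeff F n) 0 \<noteq> 0" and le: "l * n \<le> k * a" "l * n' \<le> k * b"
  shows "limit_values a b F G 0 =
    (\<Union>c. limit_values (k * a - l * n) (k * b - l * n') (blowup k l n F) (blowup k l n' G) c)"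
    (is "_ = (\<Union>c. ?L c)")
proof (rule Set.equalityI; rule Set.subsetI)
  fix w assume w: "w \<in> limit_values a b F G 0"
  obtain u v where uv: "w = (u, v)" by (cases w)
  obtain s \<xi> where *: "\<forall>i. s i \<noteq> 0" "s \<longlonglongrightarrow> 0" "\<xi> \<longlonglongrightarrow> 0"
    "(\<lambda>i. eval2 F (s i) (\<xi> i) / s i ^ a) \<longlonglongrightarrow> u" "(\<lambda>i. eval2 G (s i) (\<xi> i) / s i ^ b) \<longlonglongrightarrow> v"
    using w unfolding uv by (rule limit_valuesE)
  \<comment> \<open>Any choice of k-th roots works: their moduli are the real k-th roots of
    \<open>norm (s i)\<close>, so t tends to 0 in any case.\<close>
  have "\<exists>t. \<forall>i. s i = t i ^ k"
  proof (rule choice, rule allI)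
    fix i show "\<exists>y. s i = y ^ k" using exists_complex_root[of k "s i"] kl by (metis less_not_refl)
  qed
  then obtain t where t: "\<And>i. s i = t i ^ k" by blast
  have t0: "t i \<noteq> 0" for i using *(1) t[of i] kl by (metis zero_power)
  have "(\<lambda>i. norm (t i)) = (\<lambda>i. root k (norm (s i)))"
    using kl by (simp add: t norm_power real_root_power_cancel)
  moreover have "(\<lambda>i. root k (norm (s i))) \<longlonglongrightarrow> root k 0"
    by (intro tendsto_real_root tendsto_norm_zero *(2))
  ultimately have "(\<lambda>i. norm (t i)) \<longlonglongrightarrow> 0" by simp
  then have t_lim: "t \<longlonglongrightarrow> 0" by (rule tendsto_norm_zero_cancel)
  define z where "z i = \<xi> i / t i ^ l" for i
  have \<xi>: "\<xi> i = t i ^ l * z i" for i using t0[of i] by (simp add: z_def)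
  have limF: "(\<lambda>i. eval2 (blowup k l n F) (t i) (z i) / t i ^ (k * a - l * n)) \<longlonglongrightarrow> u"
    using *(4) by (simp add: blowup_quotient[OF F t0 le(1)] t \<xi>[symmetric])
  have limG: "(\<lambda>i. eval2 (blowup k l n' G) (t i) (z i) / t i ^ (k * b - l * n')) \<longlonglongrightarrow> v"
    using *(5) by (simp add: blowup_quotient[OF G t0 le(2)] t \<xi>[symmetric])
  have "Bseq z"
  proof (rule Bseq_blowup_coordinate[OF F kl lead t0 t_lim *(3), folded z_def])
    have "(\<lambda>i. eval2 (blowup k l n F) (t i) (z i) / t i ^ (k * a - l * n) * t i ^ (k * a - l * n))
        \<longlonglongrightarrow> u * 0 ^ (k * a - l * n)"
      by (intro tendsto_intros limF t_lim)
    then show "Bseq (\<lambda>i. eval2 (blowup k l n F) (t i) (z i))"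
      using t0 by (auto intro: convergent_imp_Bseq convergentI)
  qed
  then obtain c where "(u, v) \<in> ?L c"
    using limit_values_subsequence[OF t0 t_lim _ limF limG] by blast
  then show "w \<in> (\<Union>c. ?L c)" using uv by blast
next
  fix w assume "w \<in> (\<Union>c. ?L c)"
  then obtain c where w: "w \<in> ?L c" by blast
  obtain u v where uv: "w = (u, v)" by (cases w)
  obtain t z where *: "\<forall>i. t i \<noteq> 0" "t \<longlonglongrightarrow> 0" "z \<longlonglongrightarrow> c"
    "(\<lambda>i. eval2 (blowup k l n F) (t i) (z i) / t i ^ (k * a - l * n)) \<longlonglongrightarrow> u"
    "(\<lambda>i. eval2 (blowup k l n' G) (t i) (z i) / t i ^ (k * b - l * n')) \<longlonglongrightarrow> v"
    using w unfolding uv by (rule limit_valuesE)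
  have "(u, v) \<in> limit_values a b F G 0"
  proof (rule limit_valuesI[of "\<lambda>i. t i ^ k" "\<lambda>i. t i ^ l * z i"])
    show "t i ^ k \<noteq> 0" for i using *(1) by simp
    show "(\<lambda>i. t i ^ k) \<longlonglongrightarrow> 0" using tendsto_power[OF *(2), of k] kl by (simp add: zero_power)
    show "(\<lambda>i. t i ^ l * z i) \<longlonglongrightarrow> 0"
      using tendsto_mult[OF tendsto_power[OF *(2), of l] *(3)] kl by (simp add: zero_power)
    show "(\<lambda>i. eval2 F (t i ^ k) (t i ^ l * z i) / (t i ^ k) ^ a) \<longlonglongrightarrow> u"
      using *(1,4) by (simp add: blowup_quotient[OF F _ le(1)])
    show "(\<lambda>i. eval2 G (t i ^ k) (t i ^ l * z i) / (t i ^ k) ^ b) \<longlonglongrightarrow> v"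
      using *(1,5) by (simp add: blowup_quotient[OF G _ le(2)])
  qed
  then show "w \<in> limit_values a b F G 0" using uv by simp
qed

text \<open>A monomial in a row j < n restricts the slope to at most i / (n - j), while rows j \<ge>
  n impose nothing. The finitely many ratios are positive because the low rows vanish at s = 0,
  which forces i > 0. The least candidate is written as l / k in lowest terms.\<close>

lemma ex_minimal_slope:
  fixes F G :: bipoly and \<mu> \<alpha> d e :: nat
  assumes pos: "\<mu> > 0" "\<alpha> > 0"
    and F: "\<And>j. j < \<mu> * d \<Longrightarrow> poly (coeff F j) 0 = 0" and G: "\<And>j. j < \<mu> * e \<Longrightarrow> poly (coeff G j) 0 = 0"
  obtains k l where "k > 0" "l > 0" "coprime k l" "above_slope k l (\<mu> * d) F" "above_slope k l (\<mu> * e) G"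
    "l * \<mu> \<le> k * \<alpha>"
    "l * \<mu> = k * \<alpha> \<or> (\<exists>i j. j < \<mu> * d \<and> coeff (coeff F j) i \<noteq> 0 \<and> k * i + l * j = l * (\<mu> * d))
       \<or> (\<exists>i j. j < \<mu> * e \<and> coeff (coeff G j) i \<noteq> 0 \<and> k * i + l * j = l * (\<mu> * e))"
proof -
  define supp where "supp n H = {(i, j). j < n \<and> coeff (coeff H j) i \<noteq> 0}" for n :: nat and H :: bipoly
  define slopes where "slopes n H = (\<lambda>(i, j). real i / real (n - j)) ` supp n H" for n :: nat and H
  \<comment> \<open>The extra candidate \<alpha> / \<mu> caps the slope, so that l \<mu> \<le> k
    \<alpha>; if it is the minimum, the new exponent is 0.\<close>
  define T where "T = insert (real \<alpha> / real \<mu>) (slopes (\<mu> * d) F \<union> slopes (\<mu> * e) G)"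
  have fin: "finite (slopes n H)" for n H
  proof -
    have "supp n H \<subseteq> (\<Union>j<n. {..degree (coeff H j)} \<times> {j})"
      by (auto simp: supp_def intro: le_degree)
    then have "finite (supp n H)" by (rule finite_subset) auto
    then show ?thesis by (simp add: slopes_def)
  qed
  have slope_pos: "x > 0" if x: "x \<in> slopes n H" and low: "\<And>j. j < n \<Longrightarrow> poly (coeff H j) 0 = 0" for x n H
  proof -
    obtain i j where ij: "j < n" "coeff (coeff H j) i \<noteq> 0" "x = real i / real (n - j)"
      using x by (auto simp: slopes_def supp_def simp del: of_nat_diff)
    then have "i \<noteq> 0" using low[of j] by (cases i) (auto simp: poly_0_coeff_0)
    then show ?thesis using ij by simp
  qed
  have T: "finite T" "T \<noteq> {}" by (simp_all add: T_def fin)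
  define \<theta> where "\<theta> = Min T"
  have \<theta>: "\<theta> \<in> T" "\<And>x. x \<in> T \<Longrightarrow> \<theta> \<le> x" using T by (simp_all add: \<theta>_def)
  have \<theta>_pos: "\<theta> > 0" using \<theta>(1) slope_pos F G pos unfolding T_def by fastforce
  have "\<theta> \<in> \<rat>" using \<theta>(1) by (auto simp: T_def slopes_def)
  then obtain l k :: nat where kl: "k \<noteq> 0" "\<bar>\<theta>\<bar> = real l / real k" "coprime l k"
    by (rule Rats_abs_nat_div_natE)
  have \<theta>_eq: "\<theta> = real l / real k" using kl(2) \<theta>_pos by simp
  have l: "l > 0" using \<theta>_pos \<theta>_eq by (cases l) auto
  have le_iff: "\<theta> \<le> real i / real m \<longleftrightarrow> l * m \<le> k * i" if "m > 0" for i m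
  proof -
    have "\<theta> \<le> real i / real m \<longleftrightarrow> real (l * m) \<le> real (k * i)"
      using that kl(1) by (simp add: \<theta>_eq field_simps)
    then show ?thesis by (simp only: of_nat_le_iff)
  qed
  have eq_iff: "\<theta> = real i / real m \<longleftrightarrow> l * m = k * i" if "m > 0" for i m
  proof -
    have "\<theta> = real i / real m \<longleftrightarrow> real (l * m) = real (k * i)"
      using that kl(1) by (simp add: \<theta>_eq field_simps)
    then show ?thesis by (simp only: of_nat_eq_iff)
  qed
  have above: "above_slope k l n H" if "slopes n H \<subseteq> T" for n H
    unfolding above_slope_def
  proof (intro allI impI)
    fix i j assume c: "coeff (coeff H j) i \<noteq> 0"
    show "l * n \<le> k * i + l * j"
    proof (cases "j < n")
      case True
      then have "real i / real (n - j) \<in> T" using that c by (force simp: slopes_def supp_def)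
      then have "l * (n - j) \<le> k * i" using \<theta>(2) le_iff[of "n - j" i] True by (simp del: of_nat_diff)
      then show ?thesis by (simp add: diff_mult_distrib2)
    next
      case False
      then have "l * n \<le> l * j" by simp
      then show ?thesis by linarith
    qed
  qed
  have attained: "\<exists>i j. j < n \<and> coeff (coeff H j) i \<noteq> 0 \<and> k * i + l * j = l * n" if "\<theta> \<in> slopes n H" for n H
  proof -
    obtain i j where ij: "j < n" "coeff (coeff H j) i \<noteq> 0" "\<theta> = real i / real (n - j)"
      using \<open>\<theta> \<in> slopes n H\<close> by (auto simp: slopes_def supp_def simp del: of_nat_diff)
    then have "l * (n - j) = k * i" using eq_iff[of "n - j" i] by (simp del: of_nat_diff)
    then have "k * i + l * j = l * (n - j + j)" by (simp only: distrib_left)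
    then have "k * i + l * j = l * n" using ij by simp
    then show ?thesis using ij by blast
  qed
  show ?thesis
  proof (rule that[of k l])
    show "k > 0" "l > 0" "coprime k l" using kl l by (simp_all add: coprime_commute)
    show "above_slope k l (\<mu> * d) F" "above_slope k l (\<mu> * e) G"
      by (auto intro!: above simp: T_def)
    show "l * \<mu> \<le> k * \<alpha>" using \<theta>(2)[of "real \<alpha> / real \<mu>"] le_iff pos by (simp add: T_def)
    show "l * \<mu> = k * \<alpha> \<or> (\<exists>i j. j < \<mu> * d \<and> coeff (coeff F j) i \<noteq> 0 \<and> k * i + l * j = l * (\<mu> * d))
       \<or> (\<exists>i j. j < \<mu> * e \<and> coeff (coeff G j) i \<noteq> 0 \<and> k * i + l * j = l * (\<mu> * e))"
      using \<theta>(1) attained eq_iff[of \<mu> \<alpha>] pos unfolding T_def by blast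
  qed
qed

section \<open>Finite unions of polynomial curves\<close>

definition finite_union_of_curves :: "nat \<Rightarrow> nat \<Rightarrow> complex \<Rightarrow> complex \<Rightarrow> (complex \<times> complex) set \<Rightarrow> bool" where
  "finite_union_of_curves d e A B W \<longleftrightarrow> (\<exists>D. finite D \<and>
     (\<forall>(p, q) \<in> D. \<exists>m>0. degree p = m * d \<and> degree q = m * e \<and>
        lead_coeff p ^ e * B ^ d = lead_coeff q ^ d * A ^ e) \<and>
     W = (\<Union>(p, q) \<in> D. range (\<lambda>\<xi>. (poly p \<xi>, poly q \<xi>))))"

lemma finite_union_of_curves_empty: "finite_union_of_curves d e A B {}"
  unfolding finite_union_of_curves_def by (intro exI[of _ "{}"]) simp

lemma finite_union_of_curves_single:
  assumes "m > 0" "degree p = m * d" "degree q = m * e" "lead_coeff p ^ e * B ^ d = lead_coeff q ^ d * A ^ e"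
  shows "finite_union_of_curves d e A B (range (\<lambda>\<xi>. (poly p \<xi>, poly q \<xi>)))"
  unfolding finite_union_of_curves_def by (intro exI[of _ "{(p, q)}"]) (use assms in auto)

lemma finite_union_of_curves_Un:
  assumes "finite_union_of_curves d e A B V" "finite_union_of_curves d e A B W"
  shows "finite_union_of_curves d e A B (V \<union> W)"
proof -
  obtain C D where "finite C" "finite D"
    "\<forall>(p, q) \<in> C. \<exists>m>0. degree p = m * d \<and> degree q = m * e \<and> lead_coeff p ^ e * B ^ d = lead_coeff q ^ d * A ^ e"
    "\<forall>(p, q) \<in> D. \<exists>m>0. degree p = m * d \<and> degree q = m * e \<and> lead_coeff p ^ e * B ^ d = lead_coeff q ^ d * A ^ e"
    "V = (\<Union>(p, q) \<in> C. range (\<lambda>\<xi>. (poly p \<xi>, poly q \<xi>)))"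
    "W = (\<Union>(p, q) \<in> D. range (\<lambda>\<xi>. (poly p \<xi>, poly q \<xi>)))"
    using assms unfolding finite_union_of_curves_def by blast
  then show ?thesis
    unfolding finite_union_of_curves_def by (intro exI[of _ "C \<union> D"]) (simp add: ball_Un UN_Un)
qed

lemma finite_union_of_curves_UN:
  assumes "finite I" "\<And>i. i \<in> I \<Longrightarrow> finite_union_of_curves d e A B (W i)"
  shows "finite_union_of_curves d e A B (\<Union>i\<in>I. W i)"
  using assms
  by (induction I rule: finite_induct) (simp_all add: finite_union_of_curves_empty finite_union_of_curves_Un)

subsection \<open>Descent\<close>

locale jacobian_pair =
  fixes P Q :: bipoly and d e :: nat and A B c :: complex
  assumes jac: "jacobian P Q = [:[:c:]:]"
    and de: "d > 0" "e > 0" "gcd d e = 1"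
    and AB: "A \<noteq> 0" "B \<noteq> 0"
begin

text \<open>The coefficient conditions say that 0 is a root of \<open>special F\<close> and
  \<open>special G\<close> of multiplicity exactly \<mu> d and \<mu> e. The pole orders share the
  factor \<alpha>, so one number \<alpha> controls both exponents.\<close>

definition local_state :: "nat \<Rightarrow> nat \<Rightarrow> bipoly \<Rightarrow> bipoly \<Rightarrow> bool" where
  "local_state \<mu> \<alpha> F G \<longleftrightarrow> in_chart P Q (\<alpha> * d) (\<alpha> * e) F G \<and>
     (\<forall>j < \<mu> * d. poly (coeff F j) 0 = 0) \<and> (\<forall>j < \<mu> * e. poly (coeff G j) 0 = 0) \<and>
     poly (coeff F (\<mu> * d)) 0 \<noteq> 0 \<and> poly (coeff G (\<mu> * e)) 0 \<noteq> 0 \<and>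
     poly (coeff F (\<mu> * d)) 0 ^ e * B ^ d = poly (coeff G (\<mu> * e)) 0 ^ d * A ^ e"

lemma local_state_translate_y:
  assumes chart: "in_chart P Q (\<alpha> * d) (\<alpha> * e) F G"
    and proportional: "smult (B ^ d) (special F ^ e) = smult (A ^ e) (special G ^ d)"
    and nz: "special F \<noteq> 0" "special G \<noteq> 0" and root: "poly (special F) z = 0"
  obtains \<mu> where "\<mu> > 0" "order z (special F) = \<mu> * d" "order z (special G) = \<mu> * e"
    "local_state \<mu> \<alpha> (translate_y z F) (translate_y z G)"
proof -
  obtain \<mu> R S where \<mu>: "\<mu> > 0" "order z (special F) = \<mu> * d" "order z (special G) = \<mu> * e"
    and R: "special F = [:-z, 1:] ^ (\<mu> * d) * R" and S: "special G = [:-z, 1:] ^ (\<mu> * e) * S"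
    and RS: "poly R z \<noteq> 0" "poly S z \<noteq> 0" "poly R z ^ e * B ^ d = poly S z ^ d * A ^ e"
    using common_multiplicity[OF proportional nz AB de root] .
  have "local_state \<mu> \<alpha> (translate_y z F) (translate_y z G)"
    unfolding local_state_def
    using in_chart_translate_y[OF chart, of z] coeff_pcompose_order[OF R] coeff_pcompose_order[OF S] RS
    by (simp only: coeff_special[symmetric] special_translate_y) blast
  with that \<mu> show ?thesis by blast
qed

text \<open>One blow-up, with the induction hypothesis for the lexicographic order on (\<mu>,
  \<alpha>) passed in as an assumption.\<close>

lemma finite_union_of_curves_step:
  assumes state: "local_state \<mu> \<alpha> F G" and pos: "\<mu> > 0" "\<alpha> > 0"
    and IH: "\<And>\<mu>' \<alpha>' F' G'. \<mu>' > 0 \<Longrightarrow> \<alpha>' > 0 \<Longrightarrow> \<mu>' < \<mu> \<or> \<mu>' = \<mu> \<and> \<alpha>' < \<alpha> \<Longrightarrow>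
      local_state \<mu>' \<alpha>' F' G' \<Longrightarrow> finite_union_of_curves d e A B (limit_values (\<alpha>' * d) (\<alpha>' * e) F' G' 0)"
  shows "finite_union_of_curves d e A B (limit_values (\<alpha> * d) (\<alpha> * e) F G 0)"
proof -
  have chart: "in_chart P Q (\<alpha> * d) (\<alpha> * e) F G"
    and low: "\<And>j. j < \<mu> * d \<Longrightarrow> poly (coeff F j) 0 = 0" "\<And>j. j < \<mu> * e \<Longrightarrow> poly (coeff G j) 0 = 0"
    and lead: "poly (coeff F (\<mu> * d)) 0 \<noteq> 0" "poly (coeff G (\<mu> * e)) 0 \<noteq> 0"
    and ratio: "poly (coeff F (\<mu> * d)) 0 ^ e * B ^ d = poly (coeff G (\<mu> * e)) 0 ^ d * A ^ e"
    using state by (auto simp: local_state_def)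
  obtain k l where kl: "k > 0" "l > 0" "coprime k l"
    and above: "above_slope k l (\<mu> * d) F" "above_slope k l (\<mu> * e) G"
    and le: "l * \<mu> \<le> k * \<alpha>"
    and attained: "l * \<mu> = k * \<alpha> \<or> (\<exists>i j. j < \<mu> * d \<and> coeff (coeff F j) i \<noteq> 0 \<and> k * i + l * j = l * (\<mu> * d))
       \<or> (\<exists>i j. j < \<mu> * e \<and> coeff (coeff G j) i \<noteq> 0 \<and> k * i + l * j = l * (\<mu> * e))"
    by (rule ex_minimal_slope[OF pos low]) assumption+
  define F' where "F' = blowup k l (\<mu> * d) F"
  define G' where "G' = blowup k l (\<mu> * e) G"
  define f where "f = special F'"
  define g where "g = special G'"
  define \<alpha>' where "\<alpha>' = k * \<alpha> - l * \<mu>"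
  have exps: "k * (\<alpha> * d) - l * (\<mu> * d) = \<alpha>' * d" "k * (\<alpha> * e) - l * (\<mu> * e) = \<alpha>' * e"
    by (simp_all add: \<alpha>'_def diff_mult_distrib mult.assoc)
  have les: "l * (\<mu> * d) \<le> k * (\<alpha> * d)" "l * (\<mu> * e) \<le> k * (\<alpha> * e)"
    using le by (simp_all flip: mult.assoc)
  have chart': "in_chart P Q (\<alpha>' * d) (\<alpha>' * e) F' G'"
    using in_chart_blowup[OF chart above les] by (simp only: F'_def G'_def exps)
  have nd: "\<mu> * d > 0" "\<mu> * e > 0" using pos de by simp_all
  have vals: "limit_values (\<alpha> * d) (\<alpha> * e) F G 0 = (\<Union>z. limit_values (\<alpha>' * d) (\<alpha>' * e) F' G' z)"
    using limit_values_blowup[OF above kl(1,2) nd(1) lead(1) les] by (simp only: F'_def G'_def exps)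
  have deg: "degree f = \<mu> * d" "degree g = \<mu> * e"
    and lc: "lead_coeff f = poly (coeff F (\<mu> * d)) 0" "lead_coeff g = poly (coeff G (\<mu> * e)) 0"
    unfolding f_def g_def F'_def G'_def
    using special_blowup_leading[OF above(1) kl(1,2) lead(1)] special_blowup_leading[OF above(2) kl(1,2) lead(2)]
    by auto
  have fg: "f \<noteq> 0" "g \<noteq> 0" using deg nd by auto
  have ratio': "lead_coeff f ^ e * B ^ d = lead_coeff g ^ d * A ^ e" using ratio lc by simp
  show ?thesis
  proof (cases "\<alpha>' = 0")
    case True
    \<comment> \<open>With both exponents 0, every z contributes exactly the value (f(z), g(z));
      together these form one curve with m = \<mu>.\<close>
    have "(\<Union>z. limit_values (\<alpha>' * d) (\<alpha>' * e) F' G' z) = range (\<lambda>z. (poly f z, poly g z))"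
      using True by (simp add: limit_values_zero_exponents f_def g_def image_def) blast
    then show ?thesis
      using vals finite_union_of_curves_single[OF pos(1) deg ratio'] by simp
  next
    case False
    have \<alpha>': "\<alpha>' > 0" using False by simp
    have roots: "poly f z = 0" "poly g z = 0" if "w \<in> limit_values (\<alpha>' * d) (\<alpha>' * e) F' G' z" for w z
      using limit_values_roots[of "fst w" "snd w" "\<alpha>' * d" "\<alpha>' * e" F' G' z] that \<alpha>' de
      by (simp_all add: f_def g_def)
    define I where "I = {z. poly f z = 0 \<and> poly g z = 0}"
    have finI: "finite I"
      by (rule finite_subset[OF _ poly_roots_finite[OF fg(1)]]) (auto simp: I_def)
    have union: "(\<Union>z. limit_values (\<alpha>' * d) (\<alpha>' * e) F' G' z) = (\<Union>z\<in>I. limit_values (\<alpha>' * d) (\<alpha>' * e) F' G' z)"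
      using roots unfolding I_def by blast
    have "finite_union_of_curves d e A B (limit_values (\<alpha>' * d) (\<alpha>' * e) F' G' z)" if z: "z \<in> I" for z
    proof -
      have fz: "poly f z = 0" "poly g z = 0" using z by (simp_all add: I_def)
      \<comment> \<open>The expression is independent of \<xi>, and at the common root z both of its
        terms vanish.\<close>
      have wr: "of_nat (\<alpha>' * d) * poly f \<xi> * poly (pderiv g) \<xi> - of_nat (\<alpha>' * e) * poly g \<xi> * poly (pderiv f) \<xi> = 0" for \<xi>
        using in_chart_wronskian[OF chart' jac, of \<xi> z] fz by (simp add: f_def g_def)
      have wronskian: "smult (of_nat d) (f * pderiv g) = smult (of_nat e) (g * pderiv f)"
      proof (rule poly_eq_poly_eq_iff[THEN iffD1], rule ext)
        fix \<xi>
        have "of_nat \<alpha>' * (of_nat d * (poly f \<xi> * poly (pderiv g) \<xi>) - of_nat e * (poly g \<xi> * poly (pderiv f) \<xi>)) = 0"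
          using wr[of \<xi>] by (simp add: algebra_simps)
        then show "poly (smult (of_nat d) (f * pderiv g)) \<xi> = poly (smult (of_nat e) (g * pderiv f)) \<xi>"
          using \<alpha>' by simp
      qed
      have proportional: "smult (B ^ d) (f ^ e) = smult (A ^ e) (g ^ d)"
        by (rule power_proportional_if_wronskian_zero[OF wronskian de(1,2) pos(1) deg ratio'])
      obtain \<mu>' where \<mu>': "\<mu>' > 0" "order z f = \<mu>' * d" "order z g = \<mu>' * e"
        and state': "local_state \<mu>' \<alpha>' (translate_y z F') (translate_y z G')"
        using local_state_translate_y[OF chart' proportional[unfolded f_def g_def] fg[unfolded f_def g_def]
            fz(1)[unfolded f_def]] unfolding f_def g_def by blast
      have "\<mu>' * d \<le> \<mu> * d" using order_degree[OF fg(1), of z] deg \<mu>' by simp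
      then have le\<mu>: "\<mu>' \<le> \<mu>" using de by simp
      \<comment> \<open>If the multiplicity does not drop, the edge polynomial is a full power \<open>(\<xi> - z)\<^sup>n\<close> with \<open>z \<noteq> 0\<close>, whose
        coefficient at \<open>n - 1\<close> forces the slope \<open>l / k\<close> to be an integer.\<close>
      have "\<mu>' < \<mu> \<or> \<mu>' = \<mu> \<and> \<alpha>' < \<alpha>"
      proof (cases "\<mu>' = \<mu>")
        case True
        have f: "f = smult (lead_coeff f) ([:-z, 1:] ^ (\<mu> * d))"
          using maximal_order_decomp[OF fg(1), of z] deg \<mu>' True by simp
        have g: "g = smult (lead_coeff g) ([:-z, 1:] ^ (\<mu> * e))"
          using maximal_order_decomp[OF fg(2), of z] deg \<mu>' True by simp
        \<comment> \<open>For z = 0 both edge polynomials would be monomials, so no row below \<mu>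
          d or \<mu> e would meet the supporting line. By \<open>attained\<close> the cap would then
          be reached, contrary to \<alpha>' > 0.\<close>
        have z0: "z \<noteq> 0"
        proof
          assume z0: "z = 0"
          have mon: "[:-z, 1:] ^ n = monom 1 n" for n
            by (rule poly_eq_poly_eq_iff[THEN iffD1]) (simp add: z0 poly_monom fun_eq_iff)
          have "coeff f j = 0" if "j < \<mu> * d" for j using that f mon by (metis coeff_monom coeff_smult less_irrefl mult_zero_right)
          moreover have "coeff g j = 0" if "j < \<mu> * e" for j using that g mon by (metis coeff_monom coeff_smult less_irrefl mult_zero_right)
          moreover have "l * \<mu> \<noteq> k * \<alpha>" using \<alpha>' \<alpha>'_def by simp
          ultimately show False
            using attained coeff_special_blowup[OF above(1) kl(1)] coeff_special_blowup[OF above(2) kl(1)]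
            unfolding f_def g_def F'_def G'_def by metis
        qed
        have "coeff f (\<mu> * d - 1) = lead_coeff f * coeff ([:-z, 1:] ^ (\<mu> * d)) (\<mu> * d - 1)"
          by (subst f) simp
        also have "\<dots> \<noteq> 0"
          using fg z0 nd unfolding coeff_linear_power_pred[OF nd(1)] by simp
        finally obtain i where i: "k * i + l * (\<mu> * d - 1) = l * (\<mu> * d)"
          using coeff_special_blowup_nonzero[OF above(1)] unfolding f_def F'_def by metis
        have "l * (\<mu> * d) = l * (\<mu> * d - 1) + l"
          using nd by (cases "\<mu> * d") auto
        with i have "k * i = l" by linarith
        then have "k dvd l" by (metis dvd_triv_left)
        then have "k = 1" using kl(3) coprime_absorb_left[OF \<open>k dvd l\<close>] by simp
        \<comment> \<open>For k = 1 the new exponent is \<alpha> - l \<mu>.\<close>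
        then have "\<alpha>' < \<alpha>" using kl pos \<alpha>' by (simp add: \<alpha>'_def)
        with True show ?thesis by simp
      qed (use le\<mu> in simp)
      then show ?thesis
        using IH[OF \<mu>'(1) \<alpha>' _ state'] limit_values_translate_y[of "\<alpha>' * d" "\<alpha>' * e" F' G' z] by simp
    qed
    then show ?thesis unfolding vals union by (intro finite_union_of_curves_UN finI) auto
  qed
qed

text \<open>The induction on \<mu> is the outer one and leaves \<alpha> arbitrary, because \<alpha>
  may increase when \<mu> drops.\<close>

lemma finite_union_of_curves_limit_values:
  assumes "local_state \<mu> \<alpha> F G" "\<mu> > 0" "\<alpha> > 0"
  shows "finite_union_of_curves d e A B (limit_values (\<alpha> * d) (\<alpha> * e) F G 0)"
  using assms
proof (induction \<mu> arbitrary: \<alpha> F G rule: less_induct)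
  case (less \<mu>)
  note outer = less.IH
  show ?case using less.prems
  proof (induction \<alpha> arbitrary: F G rule: less_induct)
    case (less \<alpha>)
    show ?case
      by (rule finite_union_of_curves_step[OF less.prems]) (use outer less.IH in blast)
  qed
qed

end

subsection \<open>The nonproper value set\<close>

text \<open>The substitution \<open>x = 1/s\<close>, \<open>y = \<xi>/s\<^sup>r\<close> with \<open>r\<close> so large that \<open>y\<^sup>n\<close> dominates \<open>P\<close>
  and every nonproper sequence has \<open>\<xi> \<rightarrow> 0\<close>.\<close>

definition at_infinity_chart :: "nat \<Rightarrow> nat \<Rightarrow> bipoly \<Rightarrow> bipoly" where
  "at_infinity_chart r n P = reweight (\<lambda>i j. r * n - i - r * j) P"

text \<open>For j < n the bound i < r gives i + r j < r (j + 1) \<le> r n; row n is constant, so i =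
  0 there. Hence the subtraction never truncates, and y^n is the only monomial of weight 0.\<close>

lemma at_infinity_chart_exponents:
  assumes deg: "degree P = n" and lead: "lead_coeff P = [:a:]" and r: "\<And>j. degree (coeff P j) < r"
    and c: "coeff (coeff P j) i \<noteq> 0"
  shows "i + r * j \<le> r * n" and "r * n - i - r * j = 0 \<longleftrightarrow> j = n"
proof -
  have j: "j \<le> n" using c deg by (metis coeff_0 le_degree)
  have "i + r * j \<le> r * n \<and> (r * n - i - r * j = 0 \<longleftrightarrow> j = n)"
  proof (cases "j = n")
    case True
    then have "i = 0" using c lead deg by (cases i) auto
    then show ?thesis using True by simp
  next
    case False
    have "i < r" using c r[of j] by (meson le_degree le_less_trans)
    moreover have "r * (j + 1) \<le> r * n" using False j by (intro mult_le_mono2) simp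
    ultimately show ?thesis using False by simp
  qed
  then show "i + r * j \<le> r * n" "r * n - i - r * j = 0 \<longleftrightarrow> j = n" by auto
qed

lemma eval2_at_infinity_chart:
  assumes "degree P = n" "lead_coeff P = [:a:]" "\<And>j. degree (coeff P j) < r" and s: "s \<noteq> 0"
  shows "eval2 (at_infinity_chart r n P) s \<xi> = s ^ (r * n) * eval2 P (inverse s) (inverse (s ^ r) * \<xi>)"
  unfolding at_infinity_chart_def
proof (rule eval2_reweight)
  fix i j assume c: "coeff (coeff P j) i \<noteq> 0"
  have "r * n = (r * n - i - r * j) + i + r * j"
    using at_infinity_chart_exponents(1)[OF assms(1-3) c] by linarith
  from arg_cong[OF this, of "power s"]
  have "s ^ (r * n) = s ^ (r * n - i - r * j) * s ^ i * s ^ (r * j)"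
    by (simp only: power_add)
  then show "s ^ (r * n - i - r * j) * \<xi> ^ j = s ^ (r * n) * inverse s ^ i * (inverse (s ^ r) * \<xi>) ^ j"
    using s by (simp add: power_mult_distrib power_inverse field_simps flip: power_mult)
qed

lemma special_at_infinity_chart:
  assumes "degree P = n" "lead_coeff P = [:a:]" "\<And>j. degree (coeff P j) < r"
  shows "special (at_infinity_chart r n P) = monom a n"
proof (rule poly_eqI)
  fix j
  show "coeff (special (at_infinity_chart r n P)) j = coeff (monom a n) j"
  proof (cases "j = n")
    case True
    have "coeff (special (at_infinity_chart r n P)) n = coeff (coeff P n) 0"
      unfolding at_infinity_chart_def
    proof (rule coeff_special_reweight)
      fix i assume "coeff (coeff P n) i \<noteq> 0"
      then have "i = 0" using assms(1,2) by (cases i) auto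
      then show "r * n - i - r * n = 0 \<longleftrightarrow> i = 0" by simp
    qed
    then show ?thesis using True assms(1,2) by simp
  next
    case False
    have "coeff (special (at_infinity_chart r n P)) j = 0"
    proof (rule ccontr)
      assume "coeff (special (at_infinity_chart r n P)) j \<noteq> 0"
      then obtain i where "coeff (coeff P j) i \<noteq> 0" "r * n - i - r * j = 0"
        unfolding at_infinity_chart_def by (rule coeff_special_reweight_nonzero)
      then show False using at_infinity_chart_exponents(2)[OF assms] False by blast
    qed
    then show ?thesis using False by simp
  qed
qed

lemma lead_coeff_at_infinity_chart:
  assumes "degree P = n" "lead_coeff P = [:a:]" "a \<noteq> 0"
  shows "degree (at_infinity_chart r n P) = n" "lead_coeff (at_infinity_chart r n P) = [:a:]"
proof -
  have n: "coeff (at_infinity_chart r n P) n = [:a:]"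
    using assms by (simp add: at_infinity_chart_def coeff_reweight monom_0)
  have "degree (at_infinity_chart r n P) \<le> n"
    using degree_reweight_le assms(1) unfolding at_infinity_chart_def by metis
  moreover have "n \<le> degree (at_infinity_chart r n P)" using n assms(3) by (intro le_degree) simp
  ultimately show d: "degree (at_infinity_chart r n P) = n" by simp
  show "lead_coeff (at_infinity_chart r n P) = [:a:]" using n d by simp
qed

text \<open>If x stayed bounded along a subsequence, the bounded values of P would bound y as well,
  since the top coefficient in y is constant; then p would not tend to infinity.\<close>

lemma filterlim_norm_fst_at_infinity:
  fixes p :: "nat \<Rightarrow> complex \<times> complex"
  assumes p: "filterlim (\<lambda>i. norm (p i)) at_top sequentially"
    and P: "degree P > 0" "lead_coeff P = [:a:]" "a \<noteq> 0"
    and lim: "(\<lambda>i. eval2 P (fst (p i)) (snd (p i))) \<longlonglongrightarrow> u"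
  shows "filterlim (\<lambda>i. norm (fst (p i))) at_top sequentially"
proof (rule ccontr)
  assume "\<not> ?thesis"
  then obtain M where "\<not> eventually (\<lambda>i. M \<le> norm (fst (p i))) sequentially"
    unfolding filterlim_at_top by blast
  then have "\<exists>\<^sub>F i in sequentially. \<not> M \<le> norm (fst (p i))" by (simp add: not_eventually)
  then have "infinite {i. \<not> M \<le> norm (fst (p i))}"
    by (simp add: frequently_cofinite flip: cofinite_eq_sequentially)
  then obtain r :: "nat \<Rightarrow> nat" where r: "strict_mono r" "\<forall>i. r i \<in> {i. \<not> M \<le> norm (fst (p i))}"
    using infinite_enumerate by metis
  have x: "Bseq (\<lambda>i. fst (p (r i)))"
  proof (rule BseqI')
    show "norm (fst (p (r i))) \<le> M" for i using r(2) by (simp add: not_le less_imp_le)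
  qed
  have "(\<lambda>i. eval2 P (fst (p (r i))) (snd (p (r i)))) \<longlonglongrightarrow> u"
    using LIMSEQ_subseq_LIMSEQ[OF lim r(1)] by (simp add: o_def)
  then have "Bseq (\<lambda>i. eval2 P (fst (p (r i))) (snd (p (r i))))"
    by (intro convergent_imp_Bseq convergentI)
  then have y: "Bseq (\<lambda>i. snd (p (r i)))" by (rule Bseq_eval2_argument[OF P x])
  obtain X Y where XY: "\<And>i. norm (fst (p (r i))) \<le> X" "\<And>i. norm (snd (p (r i))) \<le> Y"
    using x y by (meson BseqE)
  have "filterlim (\<lambda>i. norm (p (r i))) at_top sequentially"
    by (rule filterlim_compose[OF p filterlim_subseq[OF r(1)]])
  then have "eventually (\<lambda>i. X + Y + 1 \<le> norm (p (r i))) sequentially"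
    unfolding filterlim_at_top by blast
  then obtain i where i: "X + Y + 1 \<le> norm (p (r i))"
    unfolding eventually_sequentially by blast
  have "norm (p (r i)) \<le> norm (fst (p (r i))) + norm (snd (p (r i)))"
    by (metis norm_Pair_le prod.collapse)
  then show False using i XY[of i] by linarith
qed

lemma nonproper_set_eq_limit_values:
  fixes P Q :: bipoly
  assumes n: "n > 0" and P: "degree P = n" "lead_coeff P = [:a:]" "a \<noteq> 0" and Q: "degree Q = n'" "lead_coeff Q = [:b:]"
    and r: "r > 0" "\<And>j. degree (coeff P j) < r" "\<And>j. degree (coeff Q j) < r"
  shows "nonproper_set (polymap P Q) =
    limit_values (r * n) (r * n') (at_infinity_chart r n P) (at_infinity_chart r n' Q) 0"
    (is "_ = limit_values _ _ ?F ?G 0")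
proof (rule Set.equalityI; rule Set.subsetI)
  note evF = eval2_at_infinity_chart[OF P(1,2) r(2)]
  note evG = eval2_at_infinity_chart[OF Q r(3)]
  fix w assume w: "w \<in> nonproper_set (polymap P Q)"
  obtain u v where uv: "w = (u, v)" by (cases w)
  obtain p where p: "filterlim (\<lambda>i. norm (p i)) at_top sequentially"
    and lim: "(\<lambda>i. polymap P Q (p i)) \<longlonglongrightarrow> (u, v)"
    using w unfolding nonproper_set_def uv by blast
  have lim1: "(\<lambda>i. eval2 P (fst (p i)) (snd (p i))) \<longlonglongrightarrow> u"
    using tendsto_fst[OF lim] by (simp add: polymap_def case_prod_beta)
  have lim2: "(\<lambda>i. eval2 Q (fst (p i)) (snd (p i))) \<longlonglongrightarrow> v"
    using tendsto_snd[OF lim] by (simp add: polymap_def case_prod_beta)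
  have x: "filterlim (\<lambda>i. norm (fst (p i))) at_top sequentially"
    using filterlim_norm_fst_at_infinity[OF p _ P(2,3) lim1] P(1) n by simp
  then have "eventually (\<lambda>i. 1 \<le> norm (fst (p i))) sequentially"
    unfolding filterlim_at_top by blast
  then obtain N where N: "\<And>i. i \<ge> N \<Longrightarrow> 1 \<le> norm (fst (p i))"
    unfolding eventually_sequentially by blast
  \<comment> \<open>The shift by N skips the terms with x = 0, for which \<open>inverse\<close>
    would return 0.\<close>
  define s where "s i = inverse (fst (p (i + N)))" for i
  define \<xi> where "\<xi> i = s i ^ r * snd (p (i + N))" for i
  have s0: "s i \<noteq> 0" for i using N[of "i + N"] by (auto simp: s_def)
  have "(\<lambda>i. inverse (fst (p i))) \<longlonglongrightarrow> 0"
    by (rule filterlim_compose[OF tendsto_inverse_0]) (use x in \<open>simp add: filterlim_at_infinity_conv_norm_at_top\<close>)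
  then have s: "s \<longlonglongrightarrow> 0" unfolding s_def by (rule LIMSEQ_ignore_initial_segment)
  have arg: "inverse (s i) = fst (p (i + N))" "inverse (s i ^ r) * \<xi> i = snd (p (i + N))" for i
    using s0[of i] by (simp_all add: \<xi>_def) (simp add: s_def)
  have limF: "(\<lambda>i. eval2 ?F (s i) (\<xi> i) / s i ^ (r * n)) \<longlonglongrightarrow> u"
    using LIMSEQ_ignore_initial_segment[OF lim1, of N] by (simp add: evF s0 arg)
  have limG: "(\<lambda>i. eval2 ?G (s i) (\<xi> i) / s i ^ (r * n')) \<longlonglongrightarrow> v"
    using LIMSEQ_ignore_initial_segment[OF lim2, of N] by (simp add: evG s0 arg)
  have "Bseq \<xi>"
  proof (rule Bseq_eval2_argument[where F = ?F and s = s])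
    show "degree ?F > 0" "lead_coeff ?F = [:a:]" "a \<noteq> 0"
      using lead_coeff_at_infinity_chart[OF P] n P(3) by simp_all
    show "Bseq s" using s by (intro convergent_imp_Bseq convergentI)
    have "(\<lambda>i. eval2 ?F (s i) (\<xi> i) / s i ^ (r * n) * s i ^ (r * n)) \<longlonglongrightarrow> u * 0 ^ (r * n)"
      by (intro tendsto_intros limF s)
    then show "Bseq (\<lambda>i. eval2 ?F (s i) (\<xi> i))"
      using s0 by (auto intro: convergent_imp_Bseq convergentI)
  qed
  then obtain z where z: "(u, v) \<in> limit_values (r * n) (r * n') ?F ?G z"
    using limit_values_subsequence[OF s0 s _ limF limG] by blast
  \<comment> \<open>As r n > 0, F must vanish at the limit point, and on s = 0 it is a
    \<xi>^n.\<close>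
  have "z = 0"
  proof -
    obtain s' \<xi>' where *: "\<forall>i. s' i \<noteq> 0" "s' \<longlonglongrightarrow> 0" "\<xi>' \<longlonglongrightarrow> z"
      "(\<lambda>i. eval2 ?F (s' i) (\<xi>' i) / s' i ^ (r * n)) \<longlonglongrightarrow> u"
      "(\<lambda>i. eval2 ?G (s' i) (\<xi>' i) / s' i ^ (r * n')) \<longlonglongrightarrow> v"
      using z by (rule limit_valuesE)
    have "(\<lambda>i. eval2 ?F (s' i) (\<xi>' i) / s' i ^ (r * n) * s' i ^ (r * n)) \<longlonglongrightarrow> u * 0 ^ (r * n)"
      by (intro tendsto_intros *)
    then have "(\<lambda>i. eval2 ?F (s' i) (\<xi>' i)) \<longlonglongrightarrow> 0" using *(1) r(1) n by (simp add: zero_power)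
    then have "eval2 ?F 0 z = 0" using tendsto_eval2[OF *(2,3)] LIMSEQ_unique by blast
    then have "poly (monom a n) z = 0"
      using special_at_infinity_chart[OF P(1,2) r(2)] by (metis poly_special)
    then show ?thesis using P(3) by (simp add: poly_monom)
  qed
  with z show "w \<in> limit_values (r * n) (r * n') ?F ?G 0" by (simp add: uv)
next
  note evF = eval2_at_infinity_chart[OF P(1,2) r(2)]
  note evG = eval2_at_infinity_chart[OF Q r(3)]
  fix w assume w: "w \<in> limit_values (r * n) (r * n') ?F ?G 0"
  obtain u v where uv: "w = (u, v)" by (cases w)
  obtain s \<xi> where *: "\<forall>i. s i \<noteq> 0" "s \<longlonglongrightarrow> 0" "\<xi> \<longlonglongrightarrow> 0"
    "(\<lambda>i. eval2 ?F (s i) (\<xi> i) / s i ^ (r * n)) \<longlonglongrightarrow> u" "(\<lambda>i. eval2 ?G (s i) (\<xi> i) / s i ^ (r * n')) \<longlonglongrightarrow> v"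
    using w unfolding uv by (rule limit_valuesE)
  define p where "p i = (inverse (s i), inverse (s i ^ r) * \<xi> i)" for i
  have "filterlim (\<lambda>i. norm (p i)) at_top sequentially"
  proof (rule filterlim_at_top_mono)
    have "filterlim s (at 0) sequentially" using * by (auto simp: filterlim_at)
    then have "filterlim (\<lambda>i. inverse (s i)) at_infinity sequentially"
      by (rule filterlim_compose[OF filterlim_inverse_at_infinity])
    then show "filterlim (\<lambda>i. norm (inverse (s i))) at_top sequentially"
      by (simp only: filterlim_at_infinity_conv_norm_at_top)
    show "eventually (\<lambda>i. norm (inverse (s i)) \<le> norm (p i)) sequentially"
      unfolding p_def by (intro always_eventually allI) (metis norm_fst_le fst_conv)
  qed
  moreover have "(\<lambda>i. polymap P Q (p i)) \<longlonglongrightarrow> (u, v)"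
    using *(1) tendsto_Pair[OF *(4,5)] by (simp add: polymap_def p_def evF evG)
  ultimately show "w \<in> nonproper_set (polymap P Q)" unfolding nonproper_set_def uv by blast
qed

lemma (in jacobian_pair) finite_union_of_curves_nonproper_set:
  assumes K: "K > 0" and P: "degree P = K * d" "lead_coeff P = [:A:]" and Q: "degree Q = K * e" "lead_coeff Q = [:B:]"
  shows "finite_union_of_curves d e A B (nonproper_set (polymap P Q))"
proof -
  \<comment> \<open>The sum dominates both degrees at once, and rows beyond the range are 0.\<close>
  define r where "r = Suc (Max ((\<lambda>j. degree (coeff P j) + degree (coeff Q j)) ` {..degree P + degree Q}))"
  have "degree (coeff P j) + degree (coeff Q j) < r" for j
  proof (cases "j \<le> degree P + degree Q")
    case True
    then have "degree (coeff P j) + degree (coeff Q j) \<le> Max ((\<lambda>j. degree (coeff P j) + degree (coeff Q j)) ` {..degree P + degree Q})"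
      by (intro Max_ge) auto
    then show ?thesis by (simp add: r_def)
  next
    case False
    then show ?thesis by (simp add: coeff_eq_0 r_def)
  qed
  then have r: "degree (coeff P j) < r" "degree (coeff Q j) < r" for j
    by (meson add_lessD1, meson add_lessD1 add.commute trans_le_add2 le_add2 le_less_trans)
  have r0: "r > 0" by (simp add: r_def)
  let ?F = "at_infinity_chart r (K * d) P" and ?G = "at_infinity_chart r (K * e) Q"
  have exps: "r * (K * d) = r * K * d" "r * (K * e) = r * K * e" by simp_all
  have special: "special ?F = monom A (K * d)" "special ?G = monom B (K * e)"
    using special_at_infinity_chart[OF P r(1)] special_at_infinity_chart[OF Q r(2)] by auto
  have chart: "in_chart P Q (r * K * d) (r * K * e) ?F ?G"
    unfolding in_chart_def
  proof (rule exI[of _ inverse], rule exI[of _ "\<lambda>_. 0"], rule exI[of _ "\<lambda>s. inverse (s ^ r)"], intro conjI allI impI)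
    fix s :: complex assume s: "s \<noteq> 0"
    show "inverse field_differentiable at s" "(\<lambda>s. inverse (s ^ r)) field_differentiable at s"
      using s by (auto intro!: field_differentiable_inverse field_differentiable_power field_differentiable_ident)
    show "(\<lambda>_. 0) field_differentiable at s" by (rule field_differentiable_const)
    show "eval2 ?F s \<xi> = s ^ (r * K * d) * eval2 P (inverse s) (0 + inverse (s ^ r) * \<xi>)" for \<xi>
      using eval2_at_infinity_chart[OF P r(1) s] by (simp add: mult.assoc)
    show "eval2 ?G s \<xi> = s ^ (r * K * e) * eval2 Q (inverse s) (0 + inverse (s ^ r) * \<xi>)" for \<xi>
      using eval2_at_infinity_chart[OF Q r(2) s] by (simp add: mult.assoc)
  qed
  \<comment> \<open>The descent starts at \<mu> = K and \<alpha> = r K, since F and G restrict to A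
    \<xi>^(K d) and B \<xi>^(K e).\<close>
  have "local_state K (r * K) ?F ?G"
    unfolding local_state_def using chart AB
    by (simp add: special mult.commute flip: coeff_special)
  then have "finite_union_of_curves d e A B (limit_values (r * K * d) (r * K * e) ?F ?G 0)"
    using finite_union_of_curves_limit_values K r0 by simp
  moreover have "nonproper_set (polymap P Q) = limit_values (r * (K * d)) (r * (K * e)) ?F ?G 0"
    using K de by (intro nonproper_set_eq_limit_values[OF _ P AB(1) Q r0 r]) simp
  ultimately show ?thesis by (simp only: exps)
qed

text \<open>By irreducibility C lies in a single curve of the union; that curve is itself
  irreducible and contained in X, so maximality of C gives equality.\<close>

lemma irreducible_component_of_finite_union:
  assumes D: "finite D" and X: "X = (\<Union>(p, q) \<in> D. range (\<lambda>\<xi>. (poly p \<xi>, poly q \<xi>)))"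
    and deg: "\<And>p q. (p, q) \<in> D \<Longrightarrow> degree p > 0 \<and> degree q > 0"
    and C: "irreducible_component C X"
  obtains p q where "(p, q) \<in> D" "C = range (\<lambda>\<xi>. (poly p \<xi>, poly q \<xi>))"
proof -
  define curve where "curve = (\<lambda>(p, q). range (\<lambda>\<xi>. (poly p \<xi>, poly q \<xi> :: complex)))"
  have X': "X = \<Union>(curve ` D)" by (simp add: X curve_def)
  have irr: "irreducible_alg (curve w)" if "w \<in> D" for w
    using deg that by (cases w) (auto simp: curve_def intro!: irreducible_alg_polynomial_curve)
  have CX: "C \<subseteq> X" "irreducible_alg C" "\<And>E. irreducible_alg E \<Longrightarrow> C \<subseteq> E \<Longrightarrow> E \<subseteq> X \<Longrightarrow> E = C"
    using C by (auto simp: irreducible_component_def)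
  have "\<exists>E\<in>curve ` D. C \<subseteq> E"
  proof (rule irreducible_alg_subset_Union)
    show "C \<subseteq> \<Union>(curve ` D)" using CX(1) X' by simp
    show "algebraic_set E" if "E \<in> curve ` D" for E
      using that irr by (auto simp: irreducible_alg_def)
  qed (use D CX(2) in simp_all)
  then obtain w where w: "w \<in> D" "C \<subseteq> curve w" by blast
  then have "curve w = C" using irr X' by (intro CX(3)) auto
  with w that show ?thesis by (cases w) (simp add: curve_def)
qed

theorem theorem1:
  fixes P Q :: bipoly and K d e :: nat and A B :: complex
  assumes jac: "\<exists>c. c \<noteq> 0 \<and> jacobian P Q = [:[:c:]:]"
    and pos: "K > 0" "d > 0" "e > 0"
    and cop: "gcd d e = 1"
    and degP: "totdeg P = K * d" and degQ: "totdeg Q = K * e"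
    and formP: "degree P = K * d" "lead_coeff P = [:A:]" "A \<noteq> 0"
    and formQ: "degree Q = K * e" "lead_coeff Q = [:B:]" "B \<noteq> 0"
    and ne: "nonproper_set (polymap P Q) \<noteq> {}"
  shows "\<forall>C. irreducible_component C (nonproper_set (polymap P Q)) \<longrightarrow>
           (\<exists>m::nat. \<exists>p q :: complex poly. m > 0 \<and>
              degree p = m * d \<and> lead_coeff p = A \<and>
              degree q = m * e \<and> lead_coeff q = B \<and>
              C = (\<lambda>\<xi>. (poly p \<xi>, poly q \<xi>)) ` UNIV)"
proof (intro allI impI)
  fix C assume C: "irreducible_component C (nonproper_set (polymap P Q))"
  obtain c where c: "jacobian P Q = [:[:c:]:]" using jac by blast
  interpret jacobian_pair P Q d e A B c
    using c pos cop formP formQ by unfold_locales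
  obtain D where D: "finite D"
    and props: "\<forall>(p, q) \<in> D. \<exists>m>0. degree p = m * d \<and> degree q = m * e \<and>
        lead_coeff p ^ e * B ^ d = lead_coeff q ^ d * A ^ e"
    and X: "nonproper_set (polymap P Q) = (\<Union>(p, q) \<in> D. range (\<lambda>\<xi>. (poly p \<xi>, poly q \<xi>)))"
    using finite_union_of_curves_nonproper_set[OF pos(1) formP(1,2) formQ(1,2)]
    unfolding finite_union_of_curves_def by blast
  have "degree p > 0 \<and> degree q > 0" if "(p, q) \<in> D" for p q
    using props that pos by fastforce
  then obtain p q where pq: "(p, q) \<in> D" and C_eq: "C = range (\<lambda>\<xi>. (poly p \<xi>, poly q \<xi>))"
    using irreducible_component_of_finite_union[OF D X _ C] by blast
  obtain m where m: "m > 0" and deg: "degree p = m * d" "degree q = m * e"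
    and ratio: "lead_coeff p ^ e * B ^ d = lead_coeff q ^ d * A ^ e"
    using props pq by blast
  obtain t where t: "t \<noteq> 0" "lead_coeff p * t ^ (m * d) = A" "lead_coeff q * t ^ (m * e) = B"
    by (rule ex_rescaling_leading_coeffs[OF de m deg AB ratio])
  \<comment> \<open>Replacing \<xi> by t \<xi> multiplies the top coefficients by t^(m d) and t^(m
    e), and keeps the image because t is nonzero.\<close>
  define p' q' where "p' = pcompose p [:0, t:]" and "q' = pcompose q [:0, t:]"
  have "degree p' = m * d" "degree q' = m * e"
    using t(1) deg by (simp_all add: p'_def q'_def degree_pcompose)
  moreover have "lead_coeff p' = A" "lead_coeff q' = B"
    unfolding p'_def q'_def by (subst lead_coeff_comp; use t deg in simp)+
  moreover have "C = range (\<lambda>\<xi>. (poly p' \<xi>, poly q' \<xi>))"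
  proof -
    have "range (\<lambda>\<xi>. (poly p \<xi>, poly q \<xi>)) = (\<lambda>\<xi>. (poly p \<xi>, poly q \<xi>)) ` range (\<lambda>\<xi>. \<xi> * t)"
    proof -
      have "\<xi> \<in> range (\<lambda>\<xi>. \<xi> * t)" for \<xi>
        using t(1) by (intro image_eqI[of _ _ "\<xi> / t"]) simp_all
      then have "range (\<lambda>\<xi>. \<xi> * t) = UNIV" by blast
      then show ?thesis by simp
    qed
    then show ?thesis unfolding C_eq by (simp add: p'_def q'_def poly_pcompose image_image)
  qed
  ultimately show "\<exists>m::nat. \<exists>p q :: complex poly. m > 0 \<and>
              degree p = m * d \<and> lead_coeff p = A \<and>
              degree q = m * e \<and> lead_coeff q = B \<and>
              C = (\<lambda>\<xi>. (poly p \<xi>, poly q \<xi>)) ` UNIV"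
    using m by blast
qed

end
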